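(* Let $e\ge 0$ and $m\ge 1$ be integers. The set of tree-decorated maps $(M,t)$ such that $M$ has $e+m$ edges, $t$ has $m$ edges, and the root edge of $M$ lies on $t$, is in bijection with the Cartesian product $\mathsf{PPT}_m\times \mathcal{S}_{e,m}$. Here $\mathcal{S}_{e,m}$ denotes the set of maps with a simple boundary of length $2m$ having $e$ interior edges, i.e. $e$ edges not on the boundary. Under this bijection, the plane-tree component is the decorating tree $t$, with the cyclic orders inherited from $M$ and rooted at the root edge of $M$.
   Context: A (rooted planar) map is a finite connected graph (loops and multiple edges allowed) embedded in the sphere, considered up to orientation-preserving homeomorphism, together with a distinguished oriented edge, the root edge. The root face is the face to the left of the root edge. A plane tree is a map with a single face; $\mathsf{PPT}_m$ denotes the set of plane trees with $m$ edges. A map with a simple boundary of length $2m$ is a rooted map whose root face (the external face) has degree $2m$ and whose boundary is a simple cycle, i.e. the $2m$ oriented edges having the external face on their left form a simple closed curve through $2m$ distinct vertices. A tree-decorated map is a pair $(M,t)$ where $M$ is a rooted map and $t$ is a subgraph of $M$ that is a tree. *)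

theory Defs
  imports "HOL-Combinatorics.Permutations"
begin

text \<open>Combinatorial (rooted) maps: a finite set of darts (half-edges), a vertex
rotation permutation sig, a fixed-point-free involution alp pairing darts into
edges, and a root dart. Faces are the orbits of phi = sig o alp.\<close>

record cmap =
  darts :: "nat set"
  sig   :: "nat \<Rightarrow> nat"
  alp   :: "nat \<Rightarrow> nat"
  root  :: nat

definition orb :: "(nat \<Rightarrow> nat) \<Rightarrow> nat \<Rightarrow> nat set" where
  "orb f d = {(f ^^ n) d | n. True}"

definition phi :: "cmap \<Rightarrow> nat \<Rightarrow> nat" where
  "phi M = sig M \<circ> alp M"

definition vertex :: "cmap \<Rightarrow> nat \<Rightarrow> nat set" where
  "vertex M d = orb (sig M) d"

definition face :: "cmap \<Rightarrow> nat \<Rightarrow> nat set" where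
  "face M d = orb (phi M) d"

definition nV :: "cmap \<Rightarrow> nat" where "nV M = card (vertex M ` darts M)"
definition nF :: "cmap \<Rightarrow> nat" where "nF M = card (face M ` darts M)"
definition nE :: "cmap \<Rightarrow> nat" where "nE M = card (darts M) div 2"

definition is_map :: "cmap \<Rightarrow> bool" where
  "is_map M \<longleftrightarrow> finite (darts M) \<and> root M \<in> darts M \<and>
     sig M permutes darts M \<and> alp M permutes darts M \<and>
     (\<forall>d\<in>darts M. alp M d \<noteq> d \<and> alp M (alp M d) = d) \<and>
     (\<forall>d\<in>darts M. (root M, d) \<in>
        ({(x, sig M x) | x. x \<in> darts M} \<union> {(x, alp M x) | x. x \<in> darts M})\<^sup>*)"

text \<open>Planar (genus 0) rooted map: Euler's formula V - E + F = 2.\<close>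
definition planar_map :: "cmap \<Rightarrow> bool" where
  "planar_map M \<longleftrightarrow> is_map M \<and> nV M + nF M = nE M + 2"

text \<open>Isomorphism of rooted maps (orientation-preserving).\<close>
definition map_iso :: "cmap \<Rightarrow> cmap \<Rightarrow> bool" where
  "map_iso M M' \<longleftrightarrow> (\<exists>f. bij_betw f (darts M) (darts M') \<and>
     (\<forall>d\<in>darts M. f (sig M d) = sig M' (f d) \<and> f (alp M d) = alp M' (f d)) \<and>
     f (root M) = root M')"

definition map_iso_rel :: "cmap set \<Rightarrow> (cmap \<times> cmap) set" where
  "map_iso_rel A = {(M, M'). M \<in> A \<and> M' \<in> A \<and> map_iso M M'}"

text \<open>Plane trees with m edges: planar maps with a single face.\<close>
definition PPT :: "nat \<Rightarrow> cmap set" where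
  "PPT m = {M. planar_map M \<and> nE M = m \<and> nF M = 1}"

text \<open>Maps with a simple boundary of length 2m (the root face) and e interior edges.\<close>
definition simple_boundary :: "cmap \<Rightarrow> nat \<Rightarrow> bool" where
  "simple_boundary M m \<longleftrightarrow> (let R = face M (root M) in
     card R = 2 * m \<and> inj_on (vertex M) R \<and> (\<forall>d\<in>R. alp M d \<notin> R))"

definition interior_edges :: "cmap \<Rightarrow> nat" where
  "interior_edges M = (let R = face M (root M) in
     card {d \<in> darts M. d \<notin> R \<and> alp M d \<notin> R} div 2)"

definition S :: "nat \<Rightarrow> nat \<Rightarrow> cmap set" where
  "S e m = {M. planar_map M \<and> simple_boundary M m \<and> interior_edges M = e}"

text \<open>A subtree of M, given by its set of darts T (closed under alp); its vertices
are the vertices of M incident to T.\<close>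
definition tree_in :: "cmap \<Rightarrow> nat set \<Rightarrow> bool" where
  "tree_in M T \<longleftrightarrow> T \<subseteq> darts M \<and> T \<noteq> {} \<and> (\<forall>d\<in>T. alp M d \<in> T) \<and>
     (let Ed = {(vertex M d, vertex M (alp M d)) | d. d \<in> T} in
        \<forall>d\<in>T. \<forall>d'\<in>T. (vertex M d, vertex M d') \<in> Ed\<^sup>*) \<and>
     card (vertex M ` T) = card T div 2 + 1"

text \<open>Tree-decorated maps with e+m edges, decorating tree with m edges containing the root edge.\<close>
definition TDM :: "nat \<Rightarrow> nat \<Rightarrow> (cmap \<times> nat set) set" where
  "TDM e m = {(M, T). planar_map M \<and> nE M = e + m \<and> tree_in M T \<and>
                      card T = 2 * m \<and> root M \<in> T}"

definition tdm_iso :: "cmap \<times> nat set \<Rightarrow> cmap \<times> nat set \<Rightarrow> bool" where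
  "tdm_iso MT MT' \<longleftrightarrow> (case MT of (M, T) \<Rightarrow> case MT' of (M', T') \<Rightarrow>
     (\<exists>f. bij_betw f (darts M) (darts M') \<and>
     (\<forall>d\<in>darts M. f (sig M d) = sig M' (f d) \<and> f (alp M d) = alp M' (f d)) \<and>
     f (root M) = root M' \<and> f ` T = T'))"

definition tdm_iso_rel :: "(cmap \<times> nat set) set \<Rightarrow> ((cmap \<times> nat set) \<times> (cmap \<times> nat set)) set" where
  "tdm_iso_rel A = {(x, y). x \<in> A \<and> y \<in> A \<and> tdm_iso x y}"

text \<open>The tree T with the cyclic orders inherited from M, rooted at the root of M.\<close>
definition induced :: "cmap \<Rightarrow> nat set \<Rightarrow> cmap" where
  "induced M T = \<lparr> darts = T,
     sig = (\<lambda>d. if d \<in> T then (sig M ^^ (LEAST k. k > 0 \<and> (sig M ^^ k) d \<in> T)) d else d),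
     alp = (\<lambda>d. if d \<in> T then alp M d else d),
     root = root M \<rparr>"

end

theory Submission
  imports Defs "HOL-Combinatorics.Cycles"
begin

text \<open>Keep the inner faces of the tree-decorated map \<open>(M, T)\<close>, that is \<open>phi\<close>, and change only the edge
  involution: each dart \<open>d\<close> of \<open>T\<close> gets a new opposite dart, and the new darts form one further face
  that follows the contour of \<open>T\<close> backwards. A corner of the tree becomes a boundary vertex, so the
  boundary is simple, and the Euler characteristic is unchanged because \<open>T\<close> has one vertex more than
  it has edges. Conversely, the contour of a plane tree with \<open>m\<close> edges and a boundary of length \<open>2m\<close>
  are cycles of the same length, so matching them root to root tells how to glue the boundary.
  Isomorphisms of the cut maps match the boundaries, hence the contours of the trees.\<close>

section \<open>Orbits of permutations\<close>

text \<open>The new face runs against the contour because it lies on the other side of every opened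
  edge.

  New darts can be named arbitrarily and everything is taken up to isomorphism, so cutting is a
  relation between \<open>M\<close>, \<open>T\<close> and \<open>N\<close> rather than a function.
  Cutting and gluing both produce instances of this one relation, and the counts are made once for
  both directions. No inverse map is built: it is enough that two decorated maps are isomorphic
  exactly when their trees and their cuts are, and that every pair of a plane tree and a bounded map
  is realised up to isomorphism.

  Two points need work. A decorating tree is only known to be connected with one vertex more than
  edges, so it has to be proved that its contour is a single cycle. And \<open>N\<close> does not
  remember how its boundary was glued, so the isomorphism of trees must supply this information when
  one returns from \<open>N\<close> to \<open>M\<close>.\<close>

lemma orb_self [simp]: "x \<in> orb p x"
  unfolding orb_def by (rule CollectI, rule exI[of _ 0]) simp

lemma funpow_in_orb: "(p ^^ n) x \<in> orb p x"
  unfolding orb_def by blast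

lemma orb_step:
  assumes "y \<in> orb p x"
  shows "p y \<in> orb p x"
proof -
  obtain n where "y = (p ^^ n) x" using assms unfolding orb_def by blast
  then have "p y = (p ^^ Suc n) x" by simp
  then show ?thesis by (metis funpow_in_orb)
qed

lemma orb_induct [consumes 1, case_names self step]:
  assumes "y \<in> orb p x" "P x" "\<And>y. y \<in> orb p x \<Longrightarrow> P y \<Longrightarrow> P (p y)"
  shows "P y"
proof -
  have "P ((p ^^ n) x)" for n
    by (induction n) (simp_all add: assms(2,3) funpow_in_orb)
  with assms(1) show ?thesis by (auto simp: orb_def)
qed

lemma orb_subsetI:
  assumes "x \<in> A" "\<And>y. y \<in> A \<Longrightarrow> p y \<in> A"
  shows "orb p x \<subseteq> A"
proof
  fix y assume "y \<in> orb p x"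
  then show "y \<in> A" by (induction rule: orb_induct) (use assms in auto)
qed

lemma orb_subset_permutes: "p permutes D \<Longrightarrow> x \<in> D \<Longrightarrow> orb p x \<subseteq> D"
  by (rule orb_subsetI) (simp_all add: permutes_in_image)

lemma funpow_permutes_period:
  assumes "p permutes D" "finite D"
  obtains n where "n > 0" "\<And>x. (p ^^ n) x = x"
  using permutation_is_nilpotent[OF permutes_imp_permutation[OF assms(2,1)]] by (metis id_apply)

text \<open>Orbits collect forward iterates only; on a finite set a permutation has a period
  \<open>n > 0\<close>, so \<open>p ^^ (n - 1)\<close> undoes one step.\<close>

lemma orb_sym:
  assumes "p permutes D" "finite D" "y \<in> orb p x"
  shows "x \<in> orb p y"
  using assms(3)
proof (induction rule: orb_induct)
  case (step y)
  obtain n where n: "n > 0" "\<And>x. (p ^^ n) x = x"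
    using funpow_permutes_period[OF assms(1,2)] by blast
  have "(p ^^ (n - 1)) (p y) = (p ^^ Suc (n - 1)) y" by (simp add: funpow_swap1)
  also have "\<dots> = y" using n by simp
  finally have "y \<in> orb p (p y)" using funpow_in_orb[of "n - 1" p "p y"] by simp
  then have "orb p y \<subseteq> orb p (p y)"
    by (intro orb_subsetI orb_step)
  then show ?case using step by blast
qed simp

lemma orb_eq:
  assumes "p permutes D" "finite D" "y \<in> orb p x"
  shows "orb p y = orb p x"
  using orb_sym[OF assms] assms(3) by (intro equalityI orb_subsetI orb_step)

lemma orb_eq_iff:
  assumes "p permutes D" "finite D"
  shows "orb p x = orb p y \<longleftrightarrow> x \<in> orb p y"
  using orb_eq[OF assms, of x y] orb_self[of x p] by blast

lemma orb_permutes_iff: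
  assumes "p permutes D" "finite D"
  shows "p y \<in> orb p x \<longleftrightarrow> y \<in> orb p x"
  using orb_eq[OF assms] by (metis orb_self orb_step)

lemma orb_cong:
  assumes "\<And>y. y \<in> orb f x \<Longrightarrow> g y = f y"
  shows "orb g x = orb f x"
proof -
  have "(g ^^ n) x = (f ^^ n) x" for n
    by (induction n) (simp_all add: assms funpow_in_orb)
  then show ?thesis by (simp add: orb_def)
qed

text \<open>A closed set contains the whole cycle of each of its points, so nothing enters it from
  outside. It makes complements of closed sets closed as well.\<close>

lemma closed_permutes_image:
  fixes p :: "nat \<Rightarrow> nat"
  assumes "p permutes D" "finite D" "Y \<subseteq> D" "\<And>y. y \<in> Y \<Longrightarrow> p y \<in> Y"
  shows "p y \<in> Y \<longleftrightarrow> y \<in> Y"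
proof
  assume "p y \<in> Y"
  moreover have "y \<in> orb p (p y)"
    using orb_sym[OF assms(1,2)] orb_step[OF orb_self] by blast
  ultimately show "y \<in> Y" using orb_subsetI[of "p y" Y p] assms(4) by auto
qed (use assms in auto)

text \<open>Needed because the boundary of a cut map follows the contour of the tree
  backwards.\<close>

lemma orb_inv:
  assumes p: "p permutes D" "finite D"
  shows "orb (inv p) x = orb p x"
proof -
  have sub: "orb (inv q) x \<subseteq> orb q x" if q: "q permutes D" for q
    by (rule orb_subsetI)
      (auto, metis orb_permutes_iff[OF q p(2)] permutes_inverses(1)[OF q])
  from sub[OF p(1)] sub[OF permutes_inv[OF p(1)]] show ?thesis
    by (simp add: permutes_inv_inv[OF p(1)])
qed

lemma orb_enum:
  assumes p: "p permutes D" "finite D" and x: "x \<in> D"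
  shows "(p ^^ card (orb p x)) x = x" "bij_betw (\<lambda>i. (p ^^ i) x) {..<card (orb p x)} (orb p x)"
proof -
  define n where "n = (LEAST n. n > 0 \<and> (p ^^ n) x = x)"
  have "\<exists>n. n > 0 \<and> (p ^^ n) x = x"
    using funpow_permutes_period[OF p] by metis
  from LeastI_ex[OF this] have n: "n > 0" "(p ^^ n) x = x" unfolding n_def by auto
  have least: "\<not> (k > 0 \<and> (p ^^ k) x = x)" if "k < n" for k
    using not_less_Least that unfolding n_def by blast
  have inj: "inj_on (\<lambda>i. (p ^^ i) x) {..<n}"
  proof (rule linorder_inj_onI)
    fix i j assume ij: "i < j" "i \<in> {..<n}" "j \<in> {..<n}"
    show "(p ^^ i) x \<noteq> (p ^^ j) x"
    proof
      assume "(p ^^ i) x = (p ^^ j) x"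
      then have "(p ^^ i) x = (p ^^ i) ((p ^^ (j - i)) x)"
        using ij by (metis comp_apply funpow_add le_add_diff_inverse less_imp_le)
      then have "x = (p ^^ (j - i)) x"
        using inj_fn[OF permutes_inj[OF p(1)]] by (auto dest: injD)
      with least[of "j - i"] ij show False by (metis diff_less_mono2 lessThan_iff less_imp_diff_less zero_less_diff)
    qed
  qed auto
  have img: "(\<lambda>i. (p ^^ i) x) ` {..<n} = orb p x"
  proof -
    have "(p ^^ k) x \<in> (\<lambda>i. (p ^^ i) x) ` {..<n}" for k
      using mod_less_divisor[OF n(1), of k] by (auto simp: funpow_mod_eq[OF n(2), symmetric, of k])
    then show ?thesis by (auto simp: orb_def)
  qed
  have "card (orb p x) = n"
    using card_image[OF inj] img by simp
  with n inj img show "(p ^^ card (orb p x)) x = x"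
    "bij_betw (\<lambda>i. (p ^^ i) x) {..<card (orb p x)} (orb p x)"
    by (auto simp: bij_betw_def)
qed

text \<open>Send the i-th iterate of \<open>x\<close> to the i-th iterate of \<open>y\<close>. This
  is the matching of a contour with a boundary, root to root, on which the gluing rests.\<close>

lemma orb_bij_equivariant:
  assumes p: "p permutes D" "finite D" "x \<in> D" and q: "q permutes D'" "finite D'" "y \<in> D'"
    and c: "card (orb p x) = card (orb q y)"
  obtains b where "bij_betw b (orb p x) (orb q y)" "b x = y" "\<And>a. a \<in> orb p x \<Longrightarrow> b (p a) = q (b a)"
proof -
  define n where "n = card (orb p x)"
  let ?f = "\<lambda>i. (p ^^ i) x" and ?g = "\<lambda>i. (q ^^ i) y"
  have f: "?f n = x" "bij_betw ?f {..<n} (orb p x)"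
    using orb_enum[OF p] by (simp_all add: n_def)
  have g: "?g n = y" "bij_betw ?g {..<n} (orb q y)"
    using orb_enum[OF q] c by (simp_all add: n_def)
  have n: "n > 0"
    using f(2) orb_self[of x p] by (cases n) (auto simp: bij_betw_def)
  define b where "b = ?g \<circ> inv_into {..<n} ?f"
  have b: "b (?f i) = ?g i" if "i < n" for i
    using inv_into_f_f[of ?f "{..<n}" i] f(2) that by (simp add: b_def bij_betw_def)
  show thesis
  proof
    show "bij_betw b (orb p x) (orb q y)"
      unfolding b_def using bij_betw_trans[OF bij_betw_inv_into[OF f(2)] g(2)] .
    show "b x = y" using b[OF n] by simp
    fix a assume "a \<in> orb p x"
    then obtain i where i: "i < n" "a = ?f i" using f(2) by (auto simp: bij_betw_def)
    show "b (p a) = q (b a)"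
    proof (cases "Suc i < n")
      case True
      then show ?thesis using b[of i] b[of "Suc i"] i by simp
    next
      \<comment> \<open>At the last index both cycles wrap around to their base points; only here
        does it matter that the lengths agree.\<close>
      case False
      then have "Suc i = n" using i by simp
      then have "p a = x" "q (?g i) = y" using f(1) g(1) i by auto
      then show ?thesis using b[of i] b[OF n] i by simp
    qed
  qed
qed

section \<open>Counting by pairs and by fibres\<close>

lemma card_even_involution:
  fixes D :: "nat set"
  assumes "finite D" "\<And>d. d \<in> D \<Longrightarrow> a d \<in> D \<and> a d \<noteq> d \<and> a (a d) = d"
  shows "even (card D)"
proof -
  let ?C = "(\<lambda>d. {d, a d}) ` D"
  have U: "\<Union>?C = D" using assms(2) by auto
  have "2 * card ?C = card (\<Union>?C)"
  proof (rule card_partition)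
    show "finite ?C" "finite (\<Union>?C)" using assms(1) U by auto
    show "card c = 2" if "c \<in> ?C" for c
      using that assms(2) by (force simp: card_2_iff)
    show "c1 \<inter> c2 = {}" if "c1 \<in> ?C" "c2 \<in> ?C" "c1 \<noteq> c2" for c1 c2
      using that assms(2) by (smt (verit) disjoint_iff doubleton_eq_iff imageE insert_iff singletonD)
  qed
  then show ?thesis using U by (metis even_mult_iff even_numeral)
qed

lemma card_doubling:
  assumes "finite H" "\<And>v. v \<in> g ` H \<Longrightarrow> card {d\<in>H. g d = v} \<ge> 2"
  shows "2 * card (g ` H) \<le> card H"
proof -
  have "2 * card (g ` H) = (\<Sum>v\<in>g ` H. 2)" by simp
  also have "\<dots> \<le> (\<Sum>v\<in>g ` H. card {d\<in>H. g d = v})"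
    using assms(2) by (intro sum_mono) auto
  also have "\<dots> = card H"
    using sum.group[of H "g ` H" g "\<lambda>_. 1::nat"] assms(1) by simp
  finally show ?thesis .
qed

section \<open>First return maps\<close>

definition first_return :: "(nat \<Rightarrow> nat) \<Rightarrow> nat set \<Rightarrow> nat \<Rightarrow> nat" where
  "first_return p T d = (p ^^ (LEAST k. k > 0 \<and> (p ^^ k) d \<in> T)) d"

lemma first_returnE:
  assumes p: "p permutes D" "finite D" and d: "d \<in> T"
  obtains k where "k > 0" "first_return p T d = (p ^^ k) d" "(p ^^ k) d \<in> T"
    "\<And>j. 0 < j \<Longrightarrow> j < k \<Longrightarrow> (p ^^ j) d \<notin> T"
proof -
  let ?P = "\<lambda>k. k > 0 \<and> (p ^^ k) d \<in> T"
  have "\<exists>k. ?P k" using funpow_permutes_period[OF p] d by metis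
  then have "?P (Least ?P)" by (rule LeastI_ex)
  moreover have "\<not> ?P j" if "j < Least ?P" for j
    using not_less_Least[OF that] .
  ultimately show thesis using that[of "Least ?P"] by (auto simp: first_return_def)
qed

lemma first_return_eqI:
  assumes "k > 0" "(p ^^ k) d \<in> T" "\<And>j. 0 < j \<Longrightarrow> j < k \<Longrightarrow> (p ^^ j) d \<notin> T"
  shows "first_return p T d = (p ^^ k) d"
proof -
  have "(LEAST k. k > 0 \<and> (p ^^ k) d \<in> T) = k"
    using assms by (intro Least_equality) (auto simp: leI, metis leI)
  then show ?thesis by (simp add: first_return_def)
qed

lemma first_return_in:
  assumes "p permutes D" "finite D" "d \<in> T"
  shows "first_return p T d \<in> T" "first_return p T d \<in> orb p d"
  using first_returnE[OF assms] by (metis, metis funpow_in_orb)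

text \<open>If \<open>d\<close> and \<open>d'\<close> return to the same point after
  \<open>k \<le> k'\<close> steps, cancelling \<open>p ^^ k\<close> puts \<open>d\<close> on the
  path of \<open>d'\<close> at time \<open>k' - k\<close>. As \<open>d\<close> is in
  \<open>T\<close>, this would be an earlier return of \<open>d'\<close> unless
  \<open>k = k'\<close>.\<close>

lemma first_return_inj_on:
  assumes p: "p permutes D" "finite D"
  shows "inj_on (first_return p T) T"
proof -
  have *: "d = d'" if "d \<in> T" "d' \<in> T" "k \<le> k'" "k > 0" "(p ^^ k) d = (p ^^ k') d'"
    "\<And>j. 0 < j \<Longrightarrow> j < k' \<Longrightarrow> (p ^^ j) d' \<notin> T" for d d' k k'
  proof -
    have "(p ^^ k) d = (p ^^ k) ((p ^^ (k' - k)) d')"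
      using that(3,5) by (metis comp_apply funpow_add le_add_diff_inverse)
    then have "d = (p ^^ (k' - k)) d'"
      using inj_fn[OF permutes_inj[OF p(1)]] by (auto dest: injD)
    with that(1,3,4) that(6)[of "k' - k"] show ?thesis by (cases "k' = k") auto
  qed
  show ?thesis
  proof (rule inj_onI)
    fix d d' assume T: "d \<in> T" "d' \<in> T" and eq: "first_return p T d = first_return p T d'"
    obtain k where k: "k > 0" "first_return p T d = (p ^^ k) d"
      "\<And>j. 0 < j \<Longrightarrow> j < k \<Longrightarrow> (p ^^ j) d \<notin> T"
      using first_returnE[OF p T(1)] by metis
    obtain k' where k': "k' > 0" "first_return p T d' = (p ^^ k') d'"
      "\<And>j. 0 < j \<Longrightarrow> j < k' \<Longrightarrow> (p ^^ j) d' \<notin> T"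
      using first_returnE[OF p T(2)] by metis
    show "d = d'"
    proof (cases "k \<le> k'")
      case True
      show ?thesis by (rule *[OF T True k(1)]) (use eq k(2) k'(2,3) in auto)
    next
      case False
      then have le: "k' \<le> k" by simp
      have "d' = d" by (rule *[OF T(2,1) le k'(1)]) (use eq k(2,3) k'(2) in auto)
      then show ?thesis by simp
    qed
  qed
qed

text \<open>Any iterate that lies in \<open>T\<close> is reached by jumping from one return to the
  next, by strong induction on its exponent. Only the values of \<open>q\<close> on \<open>T\<close>
  are constrained, since the rotation of \<open>induced\<close> is the identity elsewhere.\<close>

lemma orb_first_return:
  assumes p: "p permutes D" "finite D" and d: "d \<in> T"
    and q: "\<And>x. x \<in> T \<Longrightarrow> q x = first_return p T x"
  shows "orb q d = orb p d \<inter> T"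
proof
  show "orb q d \<subseteq> orb p d \<inter> T"
  proof (rule orb_subsetI)
    fix y assume "y \<in> orb p d \<inter> T"
    then show "q y \<in> orb p d \<inter> T"
      using first_return_in[OF p, of y T] orb_eq[OF p, of y d] q by auto
  qed (use d in auto)
  have "(p ^^ n) d \<in> T \<Longrightarrow> (p ^^ n) d \<in> orb q d" for n
    using d
  proof (induction n arbitrary: d rule: less_induct)
    case (less n)
    show ?case
    proof (cases "n = 0")
      case False
      obtain k where k: "k > 0" "first_return p T d = (p ^^ k) d" "(p ^^ k) d \<in> T"
        "\<And>j. 0 < j \<Longrightarrow> j < k \<Longrightarrow> (p ^^ j) d \<notin> T"
        using first_returnE[OF p less.prems(2)] by metis
      have kn: "k \<le> n" using k(4)[of n] less.prems(1) False by force
      then have eq: "(p ^^ n) d = (p ^^ (n - k)) ((p ^^ k) d)"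
        by (metis comp_apply funpow_add le_add_diff_inverse2)
      have "(p ^^ n) d \<in> orb q ((p ^^ k) d)"
        unfolding eq by (rule less.IH) (use k kn False less.prems eq in auto)
      moreover have "orb q ((p ^^ k) d) \<subseteq> orb q d"
        using q[OF less.prems(2)] k(2) orb_step[OF orb_self, of q d]
        by (intro orb_subsetI orb_step) auto
      ultimately show ?thesis by blast
    qed simp
  qed
  then show "orb p d \<inter> T \<subseteq> orb q d" by (auto simp: orb_def[of p])
qed

section \<open>Combinatorial maps\<close>

text \<open>A map without connectedness: cut and glued maps are first built at this level, and
  connectedness is transferred afterwards.\<close>

definition premap :: "cmap \<Rightarrow> bool" where
  "premap M \<longleftrightarrow> finite (darts M) \<and> root M \<in> darts M \<and>
     sig M permutes darts M \<and> alp M permutes darts M \<and>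
     (\<forall>d\<in>darts M. alp M d \<noteq> d \<and> alp M (alp M d) = d)"

context
  fixes M assumes M: "premap M"
begin

lemma premap_finite: "finite (darts M)"
  and premap_root: "root M \<in> darts M"
  and premap_sig: "sig M permutes darts M"
  and premap_alp: "alp M permutes darts M"
  and premap_alp_neq: "d \<in> darts M \<Longrightarrow> alp M d \<noteq> d"
  using M by (auto simp: premap_def)

lemma premap_alp_alp [simp]: "alp M (alp M d) = d"
  using M by (cases "d \<in> darts M") (auto simp: premap_def permutes_def)

lemma premap_phi: "phi M permutes darts M"
  unfolding phi_def by (rule permutes_compose[OF premap_alp premap_sig])

lemma premap_sig_eq: "sig M d = phi M (alp M d)"
  by (simp add: phi_def)

lemma premap_closed [simp]:
  "sig M d \<in> darts M \<longleftrightarrow> d \<in> darts M"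
  "alp M d \<in> darts M \<longleftrightarrow> d \<in> darts M"
  "phi M d \<in> darts M \<longleftrightarrow> d \<in> darts M"
  by (simp_all add: permutes_in_image[OF premap_sig] permutes_in_image[OF premap_alp]
      permutes_in_image[OF premap_phi])

lemma vertex_subset: "d \<in> darts M \<Longrightarrow> vertex M d \<subseteq> darts M"
  unfolding vertex_def by (rule orb_subset_permutes[OF premap_sig])

lemma face_subset: "d \<in> darts M \<Longrightarrow> face M d \<subseteq> darts M"
  unfolding face_def by (rule orb_subset_permutes[OF premap_phi])

lemma vertex_eq_iff: "vertex M x = vertex M y \<longleftrightarrow> x \<in> vertex M y"
  unfolding vertex_def by (rule orb_eq_iff[OF premap_sig premap_finite])

lemma face_eq_iff: "face M x = face M y \<longleftrightarrow> x \<in> face M y"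
  unfolding face_def by (rule orb_eq_iff[OF premap_phi premap_finite])

lemma vertex_sig [simp]: "vertex M (sig M d) = vertex M d"
  by (simp add: vertex_eq_iff) (simp add: vertex_def orb_step)

lemma vertex_self [simp]: "d \<in> vertex M d"
  by (simp add: vertex_def)

lemma face_self [simp]: "d \<in> face M d"
  by (simp add: face_def)

text \<open>Replaces paths from the root by closed sets, which are easier to move between maps. If a
  closed set misses the root, its complement is closed and contains the root, hence is
  everything.\<close>

lemma is_map_iff_closed:
  "is_map M \<longleftrightarrow>
     (\<forall>Y. Y \<subseteq> darts M \<longrightarrow> Y \<noteq> {} \<longrightarrow> (\<forall>y\<in>Y. sig M y \<in> Y \<and> alp M y \<in> Y) \<longrightarrow> Y = darts M)"
    (is "_ \<longleftrightarrow> ?closed")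
proof -
  let ?R = "{(x, sig M x) | x. x \<in> darts M} \<union> {(x, alp M x) | x. x \<in> darts M}"
  have "is_map M \<longleftrightarrow> (\<forall>d\<in>darts M. (root M, d) \<in> ?R\<^sup>*)"
    using M by (auto simp: is_map_def premap_def)
  also have "\<dots> \<longleftrightarrow> ?closed"
  proof
    assume R: "\<forall>d\<in>darts M. (root M, d) \<in> ?R\<^sup>*"
    have *: "Z = darts M"
      if Z: "Z \<subseteq> darts M" "\<And>y. y \<in> Z \<Longrightarrow> sig M y \<in> Z \<and> alp M y \<in> Z" "root M \<in> Z" for Z
    proof -
      have "d \<in> Z" if "(root M, d) \<in> ?R\<^sup>*" for d
        using that by (induction rule: rtrancl_induct) (use Z in auto)
      with R Z(1) show ?thesis by auto
    qed
    show ?closed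
    proof (intro allI impI)
      fix Y assume Y: "Y \<subseteq> darts M" "Y \<noteq> {}" "\<forall>y\<in>Y. sig M y \<in> Y \<and> alp M y \<in> Y"
      show "Y = darts M"
      proof (cases "root M \<in> Y")
        case True then show ?thesis using * Y by blast
      next
        case False
        have s: "sig M y \<in> Y \<longleftrightarrow> y \<in> Y" and a: "alp M y \<in> Y \<longleftrightarrow> y \<in> Y" for y
          using closed_permutes_image[OF premap_sig premap_finite Y(1)]
            closed_permutes_image[OF premap_alp premap_finite Y(1)] Y(3) by auto
        have "darts M - Y = darts M"
          by (rule *) (use False premap_root in \<open>auto simp: s a\<close>)
        then show ?thesis using Y(1,2) by blast
      qed
    qed
  next
    assume C: ?closed
    let ?Y = "{d \<in> darts M. (root M, d) \<in> ?R\<^sup>*}"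
    have "?Y = darts M"
    proof (rule C[rule_format])
      show "?Y \<noteq> {}" using premap_root by auto
      fix y assume y: "y \<in> ?Y"
      then have "(y, sig M y) \<in> ?R" "(y, alp M y) \<in> ?R" by auto
      with y show "sig M y \<in> ?Y \<and> alp M y \<in> ?Y"
        by (auto intro: rtrancl_into_rtrancl simp del: Un_iff)
    qed auto
    then show "\<forall>d\<in>darts M. (root M, d) \<in> ?R\<^sup>*" by blast
  qed
  finally show ?thesis .
qed

lemma nF_eq_1_iff: "nF M = 1 \<longleftrightarrow> face M (root M) = darts M"
proof
  assume "nF M = 1"
  then obtain X where X: "face M ` darts M = {X}"
    unfolding nF_def by (auto simp: card_1_singleton_iff)
  have *: "face M d = X" if "d \<in> darts M" for d
    using imageI[OF that, of "face M"] unfolding X by simp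
  have "d \<in> face M (root M)" if "d \<in> darts M" for d
    using *[OF that] *[OF premap_root] face_self[of d] by simp
  then show "face M (root M) = darts M" using face_subset[OF premap_root] by auto
next
  assume *: "face M (root M) = darts M"
  have "face M d = darts M" if "d \<in> darts M" for d
    using face_eq_iff[of d "root M"] that * by auto
  then have "face M ` darts M = {darts M}" using premap_root by force
  then show "nF M = 1" by (simp add: nF_def)
qed

lemma card_darts_even: "even (card (darts M))"
  by (rule card_even_involution[OF premap_finite, of "alp M"]) (auto simp: premap_alp_neq)

end

lemma is_map_premap: "is_map M \<Longrightarrow> premap M"
  by (auto simp: is_map_def premap_def)

lemma is_map_closed_eq:
  assumes "is_map M" "Y \<subseteq> darts M" "Y \<noteq> {}" "\<And>y. y \<in> Y \<Longrightarrow> sig M y \<in> Y" "\<And>y. y \<in> Y \<Longrightarrow> alp M y \<in> Y"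
  shows "Y = darts M"
  using is_map_iff_closed[OF is_map_premap[OF assms(1)]] assms by blast

lemma is_mapI:
  assumes "premap M"
    "\<And>Y. Y \<subseteq> darts M \<Longrightarrow> Y \<noteq> {} \<Longrightarrow> (\<And>y. y \<in> Y \<Longrightarrow> sig M y \<in> Y) \<Longrightarrow>
       (\<And>y. y \<in> Y \<Longrightarrow> alp M y \<in> Y) \<Longrightarrow> Y = darts M"
  shows "is_map M"
  using is_map_iff_closed[OF assms(1)] assms(2) by blast

section \<open>The single face of a tree\<close>

text \<open>Going once around a cycle, \<open>X\<close> is entered as often as it is left. Formally,
  \<open>p\<close> maps the darts whose successor is in \<open>X\<close> onto those in
  \<open>X\<close>, so the two differences of these sets have equal size.\<close>

lemma change_twice:
  assumes "p permutes D" "finite D" and v: "v = orb p x" "x \<in> D"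
    and ne: "{d\<in>v. (d \<in> X) \<noteq> (p d \<in> X)} \<noteq> {}"
  shows "card {d\<in>v. (d \<in> X) \<noteq> (p d \<in> X)} \<ge> 2"
proof -
  let ?A = "{d\<in>v. d \<in> X}" and ?B = "{d\<in>v. p d \<in> X}"
  have fin: "finite v" using finite_subset[OF orb_subset_permutes] assms by blast
  have pv: "p d \<in> v \<longleftrightarrow> d \<in> v" for d
    unfolding v by (rule orb_permutes_iff[OF assms(1,2)])
  have "p ` ?B = ?A"
  proof
    show "?A \<subseteq> p ` ?B"
    proof
      fix d assume d: "d \<in> ?A"
      then have "d = p (inv p d)" by (simp add: permutes_inverses[OF assms(1)])
      with d show "d \<in> p ` ?B" using pv by (metis (mono_tags, lifting) imageI mem_Collect_eq)
    qed
  qed (use pv in auto)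
  then have "card ?A = card ?B"
    using card_image[OF inj_on_subset[OF permutes_inj[OF assms(1)]], of ?B] by auto
  then have c: "card (?A - ?B) = card (?B - ?A)"
    using fin by (simp add: card_Diff_subset_Int Int_commute)
  have u: "{d\<in>v. (d \<in> X) \<noteq> (p d \<in> X)} = (?A - ?B) \<union> (?B - ?A)" by auto
  have s: "card ((?A - ?B) \<union> (?B - ?A)) = card (?A - ?B) + card (?B - ?A)"
    using fin by (intro card_Un_disjoint) auto
  have "card {d\<in>v. (d \<in> X) \<noteq> (p d \<in> X)} \<noteq> 0"
    using ne fin by (simp only: card_eq_0_iff) auto
  then have "card ((?A - ?B) \<union> (?B - ?A)) > 0" unfolding u by (simp only: neq0_conv)
  moreover have "2 \<le> i" if "i = j + k" "j = k" "i > 0" for i j k :: nat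
    using that by presburger
  ultimately show ?thesis unfolding u using s c by blast
qed

text \<open>Adjacent vertices are added to \<open>U\<close> one by one; each brings at least one new edge.\<close>

lemma vertex_growth:
  assumes M: "is_map M" and U: "U \<subseteq> vertex M ` darts M" "U \<noteq> {}"
    and c: "2 * card U \<le> card {d\<in>darts M. vertex M d \<in> U \<and> vertex M (alp M d) \<in> U}"
  shows "2 * nV M \<le> card (darts M)"
  using U c
proof (induction "nV M - card U" arbitrary: U rule: less_induct)
  case less
  note M' = is_map_premap[OF M]
  let ?V = "vertex M ` darts M"
  let ?I = "\<lambda>U. {d\<in>darts M. vertex M d \<in> U \<and> vertex M (alp M d) \<in> U}"
  have fin: "finite (darts M)" "finite U"
    using premap_finite[OF M'] less.prems(1) finite_subset by blast+
  show ?case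
  proof (cases "U = ?V")
    case True
    have "card (?I U) \<le> card (darts M)" using fin by (intro card_mono) auto
    then show ?thesis using True less.prems by (simp add: nV_def)
  next
    case False
    let ?Y = "{d\<in>darts M. vertex M d \<in> U}"
    have "\<exists>d\<in>?Y. vertex M (alp M d) \<notin> U"
    proof (rule ccontr)
      assume "\<not> ?thesis"
      then have "?Y = darts M"
        using less.prems(1,2) by (intro is_map_closed_eq[OF M]) (auto simp: M')
      then show False using False less.prems(1) by auto
    qed
    then obtain d where d: "d \<in> darts M" "vertex M d \<in> U" "vertex M (alp M d) \<notin> U" by auto
    let ?U = "insert (vertex M (alp M d)) U"
    have cU: "card ?U = Suc (card U)" using d fin by simp
    have sub: "?U \<subseteq> ?V" using d less.prems(1) M' by auto
    have "card ?U \<le> nV M" unfolding nV_def using sub fin by (intro card_mono) auto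
    then have dec: "nV M - card ?U < nV M - card U" using cU by simp
    \<comment> \<open>The new edge contributes both of its darts, and neither was counted before
      because one of its ends was outside \<open>U\<close>. So both sides of the invariant can grow
      by 2.\<close>
    have "card (?I U \<union> {d, alp M d}) \<le> card (?I ?U)"
      using d fin M' by (intro card_mono) auto
    moreover have "card (?I U \<union> {d, alp M d}) = card (?I U) + card {d, alp M d}"
      using d fin M' by (intro card_Un_disjoint) auto
    moreover have "card {d, alp M d} = 2"
      using premap_alp_neq[OF M' d(1)] by (metis card_2_iff)
    ultimately have "2 * card ?U \<le> card (?I ?U)"
      using less.prems(3) cU by linarith
    then show ?thesis using less.hyps[OF dec sub] by simp
  qed
qed

text \<open>The darts separating a face from a different one would form a subgraph without vertices of
  degree one, so with at least as many edges as vertices; this is impossible in a tree.\<close>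

lemma tree_single_face:
  assumes M: "is_map M" and V: "nV M = nE M + 1"
  shows "nF M = 1"
proof -
  note M' = is_map_premap[OF M]
  note fin = premap_finite[OF M'] and sig = premap_sig[OF M']
  define X where "X = face M (root M)"
  \<comment> \<open>As \<open>sig M d = phi M (alp M d)\<close> lies in the same face as
    \<open>alp M d\<close>, these are the darts of the edges that have \<open>X\<close> on exactly
    one side.\<close>
  define H where "H = {d\<in>darts M. (d \<in> X) \<noteq> (sig M d \<in> X)}"
  have phi: "phi M d \<in> X \<longleftrightarrow> d \<in> X" for d
    unfolding X_def face_def by (rule orb_permutes_iff[OF premap_phi[OF M'] fin])
  have sig_alp: "sig M d \<in> X \<longleftrightarrow> alp M d \<in> X" for d
    using phi[of "alp M d"] premap_sig_eq[OF M'] by simp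
  have "H = {}"
  proof (rule ccontr)
    assume H: "H \<noteq> {}"
    have finH: "finite H" using fin by (simp add: H_def)
    have "2 * card (vertex M ` H) \<le> card H"
    proof (rule card_doubling[OF finH])
      fix v assume "v \<in> vertex M ` H"
      then obtain x where x: "x \<in> H" "v = vertex M x" by auto
      have "x \<in> darts M" using x by (simp add: H_def)
      then have eq: "{d\<in>H. vertex M d = v} = {d\<in>v. (d \<in> X) \<noteq> (sig M d \<in> X)}"
        using vertex_subset[OF M'] vertex_eq_iff[OF M'] x(2) by (auto simp: H_def)
      have "x \<in> {d\<in>H. vertex M d = v}" using x by simp
      then show "card {d\<in>H. vertex M d = v} \<ge> 2"
        unfolding eq using x(2) \<open>x \<in> darts M\<close>
        by (intro change_twice[OF sig fin]) (auto simp: vertex_def)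
    qed
    also have "card H \<le> card {d\<in>darts M. vertex M d \<in> vertex M ` H \<and> vertex M (alp M d) \<in> vertex M ` H}"
    proof (rule card_mono)
      have "alp M d \<in> H" if "d \<in> H" for d
        using that sig_alp by (auto simp: H_def M')
      then show "H \<subseteq> {d\<in>darts M. vertex M d \<in> vertex M ` H \<and> vertex M (alp M d) \<in> vertex M ` H}"
        by (auto simp: H_def)
    qed (use fin in simp)
    finally have "2 * nV M \<le> card (darts M)"
      using H by (intro vertex_growth[OF M, of "vertex M ` H"]) (auto simp: H_def)
    with V show False by (simp add: nE_def)
  qed
  then have "d \<in> X \<longleftrightarrow> sig M d \<in> X" if "d \<in> darts M" for d
    using that by (auto simp: H_def)
  moreover have X: "X \<subseteq> darts M" "X \<noteq> {}"
    using face_subset[OF M' premap_root[OF M']] face_self[OF M'] by (auto simp: X_def)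
  ultimately have "X = darts M"
    using sig_alp by (intro is_map_closed_eq[OF M]) auto
  then show ?thesis using nF_eq_1_iff[OF M'] by (simp add: X_def)
qed

section \<open>Subtrees as induced maps\<close>

lemma induced_simps [simp]:
  "darts (induced M T) = T" "root (induced M T) = root M"
  "d \<in> T \<Longrightarrow> alp (induced M T) d = alp M d"
  "d \<in> T \<Longrightarrow> sig (induced M T) d = first_return (sig M) T d"
  by (simp_all add: induced_def first_return_def)

context
  fixes M T
  assumes M: "premap M" and T: "T \<subseteq> darts M" "root M \<in> T" "\<And>d. d \<in> T \<Longrightarrow> alp M d \<in> T"
begin

lemma premap_induced: "premap (induced M T)"
proof -
  note sig = premap_sig[OF M] premap_finite[OF M]
  have "finite T" using T(1) sig(2) finite_subset by blast
  moreover have "sig (induced M T) permutes T"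
  proof (rule inj_imp_permutes)
    show "inj_on (sig (induced M T)) T"
      using first_return_inj_on[OF sig, of T] by (simp cong: inj_on_cong)
    show "sig (induced M T) x \<in> T" if "x \<in> T" for x
      using first_return_in(1)[OF sig that] that by simp
  qed (use \<open>finite T\<close> in \<open>simp_all add: induced_def\<close>)
  moreover have "alp (induced M T) permutes T"
  proof (rule inj_imp_permutes)
    show "inj_on (alp (induced M T)) T"
      using permutes_inj_on[OF premap_alp[OF M], of T] by (simp cong: inj_on_cong)
  qed (use \<open>finite T\<close> T(3) in \<open>simp_all add: induced_def\<close>)
  ultimately show ?thesis
    using T(2,3) premap_alp_neq[OF M] T(1) by (auto simp: premap_def premap_alp_alp[OF M])
qed

lemma vertex_induced: "d \<in> T \<Longrightarrow> vertex (induced M T) d = vertex M d \<inter> T"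
  unfolding vertex_def
  by (rule orb_first_return[OF premap_sig[OF M] premap_finite[OF M]]) auto

lemma nV_induced: "nV (induced M T) = card (vertex M ` T)"
proof -
  have "inj_on (\<lambda>v. v \<inter> T) (vertex M ` T)"
  proof (rule inj_onI)
    fix v w assume vw: "v \<in> vertex M ` T" "w \<in> vertex M ` T" and eq: "v \<inter> T = w \<inter> T"
    then obtain x where x: "x \<in> T" "v = vertex M x" by auto
    then have "x \<in> w" using eq vertex_self[OF M] by blast
    then show "v = w" using vw(2) vertex_eq_iff[OF M] x(2) by auto
  qed
  moreover have "vertex (induced M T) ` T = (\<lambda>v. v \<inter> T) ` vertex M ` T"
    by (simp add: image_image vertex_induced cong: image_cong_simp)
  ultimately show ?thesis by (simp add: nV_def card_image)
qed

text \<open>A closed set of darts of the induced map contains with one dart all darts of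
  \<open>T\<close> at the same vertex, by \<open>vertex_induced\<close>. So closed sets correspond
  to sets of vertices closed under adjacency in the tree.\<close>

lemma tree_in_iff:
  "tree_in M T \<longleftrightarrow> is_map (induced M T) \<and> nV (induced M T) = nE (induced M T) + 1"
proof -
  let ?E = "{(vertex M d, vertex M (alp M d)) | d. d \<in> T}"
  have "(\<forall>d\<in>T. \<forall>d'\<in>T. (vertex M d, vertex M d') \<in> ?E\<^sup>*) \<longleftrightarrow> is_map (induced M T)"
  proof
    assume E: "\<forall>d\<in>T. \<forall>d'\<in>T. (vertex M d, vertex M d') \<in> ?E\<^sup>*"
    show "is_map (induced M T)"
    proof (rule is_mapI[OF premap_induced])
      fix Y assume Y: "Y \<subseteq> darts (induced M T)" "Y \<noteq> {}"
        "\<And>y. y \<in> Y \<Longrightarrow> sig (induced M T) y \<in> Y" "\<And>y. y \<in> Y \<Longrightarrow> alp (induced M T) y \<in> Y"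
      have YT: "Y \<subseteq> T" using Y(1) by simp
      have vY: "d' \<in> Y" if "d \<in> Y" "d' \<in> T" "vertex M d' = vertex M d" for d d'
      proof -
        have "d' \<in> vertex (induced M T) d"
          using that YT vertex_eq_iff[OF M] by (auto simp: vertex_induced)
        moreover have "vertex (induced M T) d \<subseteq> Y"
          unfolding vertex_def by (rule orb_subsetI) (use that(1) Y(3) in auto)
        ultimately show ?thesis by blast
      qed
      obtain y where y: "y \<in> Y" using Y(2) by blast
      have "\<exists>d\<in>Y. vertex M d = v" if "(vertex M y, v) \<in> ?E\<^sup>*" for v
        using that
      proof (induction rule: rtrancl_induct)
        case (step v w)
        then obtain d x where "d \<in> Y" "vertex M d = v" "x \<in> T" "v = vertex M x" "w = vertex M (alp M x)"
          by blast
        then have "x \<in> Y" using vY[of d x] by simp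
        then have "alp M x \<in> Y" using Y(4)[of x] \<open>x \<in> T\<close> by simp
        then show ?case using \<open>w = _\<close> by blast
      qed (use y in blast)
      then have "d \<in> Y" if "d \<in> T" for d
      proof -
        have "(vertex M y, vertex M d) \<in> ?E\<^sup>*" using E y YT that by blast
        then obtain d' where "d' \<in> Y" "vertex M d' = vertex M d"
          using \<open>\<And>v. (vertex M y, v) \<in> ?E\<^sup>* \<Longrightarrow> \<exists>d\<in>Y. vertex M d = v\<close> by blast
        then show ?thesis using vY[of d' d] that by simp
      qed
      then show "Y = darts (induced M T)" using YT by auto
    qed
  next
    assume I: "is_map (induced M T)"
    show "\<forall>d\<in>T. \<forall>d'\<in>T. (vertex M d, vertex M d') \<in> ?E\<^sup>*"
    proof (intro ballI)
      fix d d' assume d: "d \<in> T" "d' \<in> T"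
      let ?Y = "{x\<in>T. (vertex M d, vertex M x) \<in> ?E\<^sup>*}"
      have "?Y = darts (induced M T)"
      proof (rule is_map_closed_eq[OF I])
        show "sig (induced M T) y \<in> ?Y" if "y \<in> ?Y" for y
        proof -
          have "y \<in> T" using that by simp
          note fr = first_return_in[OF premap_sig[OF M] premap_finite[OF M] this]
          have "vertex M (first_return (sig M) T y) = vertex M y"
            using fr(2) vertex_eq_iff[OF M] by (simp add: vertex_def)
          then show ?thesis using that fr(1) by simp
        qed
        show "alp (induced M T) y \<in> ?Y" if "y \<in> ?Y" for y
        proof -
          have "(vertex M y, vertex M (alp M y)) \<in> ?E" using that by blast
          then have "(vertex M d, vertex M (alp M y)) \<in> ?E\<^sup>*"
            using that by (blast intro: rtrancl_into_rtrancl)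
          then show ?thesis using that T(3) by simp
        qed
      qed (use d in auto)
      then show "(vertex M d, vertex M d') \<in> ?E\<^sup>*" using d by auto
    qed
  qed
  note conn = this
  show ?thesis
    unfolding tree_in_def Let_def conn using T by (auto simp: nV_induced nE_def)
qed

text \<open>Planarity of the tree is not inherited from \<open>M\<close>:
  \<open>tree_single_face\<close> yields one face, and with V = E + 1 Euler's formula
  follows.\<close>

lemma tree_in_induced_PPT:
  assumes "tree_in M T" "card T = 2 * m"
  shows "induced M T \<in> PPT m"
  using assms tree_single_face[of "induced M T"]
  by (auto simp: tree_in_iff PPT_def planar_map_def nE_def)

end

text \<open>Prepares the comparison of a map with its cut: vertices away from the tree or the
  boundary are literally the same sets in both, so only the others have to be counted.\<close>

lemma nV_split:
  assumes M: "premap M" and X: "X \<subseteq> darts M"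
  shows "nV M = card {v\<in>vertex M ` darts M. v \<inter> X = {}} + card (vertex M ` X)"
proof -
  let ?U = "{v\<in>vertex M ` darts M. v \<inter> X = {}}"
  have "v \<in> ?U \<union> vertex M ` X" if v: "v \<in> vertex M ` darts M" for v
  proof (cases "v \<inter> X = {}")
    case False
    then obtain d where d: "d \<in> v" "d \<in> X" by blast
    then have "v = vertex M d" using v vertex_eq_iff[OF M, of d] by auto
    then show ?thesis using d by blast
  qed (use v in blast)
  then have "vertex M ` darts M = ?U \<union> vertex M ` X" using X by blast
  moreover have "?U \<inter> vertex M ` X = {}"
    using vertex_self[OF M] by blast
  moreover have "finite (vertex M ` darts M)" using premap_finite[OF M] by simp
  ultimately show ?thesis
    unfolding nV_def by (metis card_Un_disjoint finite_Un)
qed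

section \<open>Cutting a map along a subtree\<close>

text \<open>\<open>N\<close> arises from \<open>M\<close> by opening every edge of \<open>T\<close> into a 2-gon: a dart \<open>d \<in> T\<close> keeps its face and
  is glued to a new boundary dart \<open>alp N d\<close>, and the boundary runs along the contour of the tree
  backwards.\<close>

locale cutting =
  fixes M T N
  assumes M: "premap M" and N: "premap N"
    and T: "T \<subseteq> darts M" "root M \<in> T" "\<And>d. d \<in> T \<Longrightarrow> alp M d \<in> T"
    and disj: "darts M \<inter> alp N ` T = {}"
    and darts: "darts N = darts M \<union> alp N ` T"
    and alp_eq: "\<And>d. d \<in> darts M \<Longrightarrow> d \<notin> T \<Longrightarrow> alp N d = alp M d"
    and phi_eq: "\<And>d. d \<in> darts M \<Longrightarrow> phi N d = phi M d"
    and phi_boundary: "\<And>d. d \<in> T \<Longrightarrow> phi N (alp N (phi (induced M T) d)) = alp N d"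
    and root: "root N = alp N (root M)"
    and single: "nF (induced M T) = 1"
begin

abbreviation (input) "A \<equiv> induced M T"
abbreviation (input) "R \<equiv> alp N ` T"

lemmas A = premap_induced[OF M T]
lemmas alpM = premap_alp_alp[OF M] and alpN = premap_alp_alp[OF N]
lemmas finM = premap_finite[OF M] and finN = premap_finite[OF N]

lemma finT: "finite T"
  using T(1) finM finite_subset by blast

lemma alp_mem: "alp N d \<in> R \<longleftrightarrow> d \<in> T" "alp N d \<in> T \<longleftrightarrow> d \<in> R"
  using inj_image_mem_iff[OF permutes_inj[OF premap_alp[OF N]]] alpN by (auto, metis image_eqI)

lemma R_disj: "d \<in> R \<Longrightarrow> d \<notin> darts M" "d \<in> R \<Longrightarrow> d \<notin> T"
  using disj T(1) by auto

section \<open>The boundary face as the reversed contour\<close>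

lemma contour: "orb (phi A) (root M) = T"
  using nF_eq_1_iff[OF A] single by (simp add: face_def)

lemma phi_induced_in: "d \<in> T \<Longrightarrow> phi A d \<in> T"
  using premap_closed(3)[OF A, of d] by simp

lemma phi_R: "d \<in> T \<Longrightarrow> phi N (alp N d) = alp N (inv (phi A) d)"
  using phi_boundary[of "inv (phi A) d"] permutes_inverses(1)[OF premap_phi[OF A], of d]
    permutes_in_image[OF permutes_inv[OF premap_phi[OF A]], of d] by simp

text \<open>Through \<open>alp N\<close>, \<open>phi N\<close> acts on the boundary as the inverse
  of the contour permutation does on \<open>T\<close>, and the latter is a single cycle because the
  tree has one face.\<close>

lemma face_root: "face N (root N) = R"
proof -
  have "(inv (phi A) ^^ n) (root M) \<in> T \<and> (phi N ^^ n) (root N) = alp N ((inv (phi A) ^^ n) (root M))" for n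
  proof (induction n)
    case (Suc n)
    then show ?case
      using phi_R permutes_in_image[OF permutes_inv[OF premap_phi[OF A]]] by simp
  qed (use root T in simp)
  then have "orb (phi N) (root N) = alp N ` orb (inv (phi A)) (root M)"
    by (auto simp: orb_def)
  also have "orb (inv (phi A)) (root M) = T"
    using orb_inv[OF premap_phi[OF A] premap_finite[OF A]] contour by simp
  finally show ?thesis by (simp add: face_def)
qed

lemma card_R: "card R = card T"
  by (rule card_image) (rule permutes_inj_on[OF premap_alp[OF N]])

section \<open>Rotation of the cut map and its boundary vertices\<close>

lemma sig_outside: "d \<in> darts M \<Longrightarrow> d \<notin> T \<Longrightarrow> sig N d = sig M d"
  using premap_sig_eq[OF N] premap_sig_eq[OF M] alp_eq phi_eq premap_closed(2)[OF M] by simp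

lemma sig_T: "d \<in> T \<Longrightarrow> sig N d \<in> R"
  using premap_sig_eq[OF N, of d] phi_R permutes_in_image[OF permutes_inv[OF premap_phi[OF A]], of d] by auto

lemma sig_R: "d \<in> T \<Longrightarrow> sig N (alp N (alp M d)) = sig M d"
  using premap_sig_eq[OF N, of "alp N (alp M d)"] premap_sig_eq[OF M, of d] phi_eq T by (auto simp: alpN)

lemma sig_T_eq:
  assumes "d \<in> T"
  shows "sig N (sig A d) = alp N (alp M d)"
proof -
  have "sig A d = phi A (alp M d)" using premap_sig_eq[OF A, of d] assms by simp
  moreover have "sig N (phi A (alp M d)) = alp N (alp M d)"
    using phi_boundary[of "alp M d"] premap_sig_eq[OF N] assms T(3) by simp
  ultimately show ?thesis by simp
qed

text \<open>The vertex is a corner of the tree: from the boundary dart, \<open>sig N\<close> moves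
  to \<open>sig M d\<close>, follows \<open>sig M\<close> up to the next tree dart
  \<open>sig A d\<close>, and returns. So it carries no second boundary dart, which is what makes
  the boundary simple.\<close>

lemma vertex_N_boundary:
  assumes "d \<in> T"
  shows "vertex N (alp N (alp M d)) \<subseteq> insert (alp N (alp M d)) (darts M)"
proof -
  let ?r = "alp N (alp M d)"
  obtain k where k: "k > 0" "first_return (sig M) T d = (sig M ^^ k) d" "(sig M ^^ k) d \<in> T"
      "\<And>j. 0 < j \<Longrightarrow> j < k \<Longrightarrow> (sig M ^^ j) d \<notin> T"
    using first_returnE[OF premap_sig[OF M] finM assms] by metis
  \<comment> \<open>The index 0 is left out because \<open>d\<close> itself closes the preceding
    corner; the index \<open>k\<close> is included because the next tree dart closes this
    one.\<close>
  define Y where "Y = insert ?r {(sig M ^^ j) d | j. 0 < j \<and> j \<le> k}"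
  have "vertex N ?r \<subseteq> Y"
    unfolding vertex_def
  proof (rule orb_subsetI)
    fix y assume "y \<in> Y"
    then consider "y = ?r" | j where "0 < j" "j < k" "y = (sig M ^^ j) d" | "y = (sig M ^^ k) d"
      by (auto simp: Y_def le_less)
    then show "sig N y \<in> Y"
    proof cases
      case 1
      then show ?thesis using sig_R[OF assms] k(1) by (auto simp: Y_def intro!: exI[of _ "Suc 0"])
    next
      case 2
      have "y \<in> darts M" "y \<notin> T"
        using 2 k(4) permutes_in_funpow_image[OF premap_sig[OF M]] assms T(1) by auto
      then have "sig N y = (sig M ^^ Suc j) d" using sig_outside 2(3) by simp
      then show ?thesis using 2 by (auto simp: Y_def intro!: exI[of _ "Suc j"])
    next
      case 3
      then have "y = sig A d" using k(2) assms by simp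
      then show ?thesis using sig_T_eq[OF assms] by (simp add: Y_def)
    qed
  qed (simp add: Y_def)
  also have "Y \<subseteq> insert ?r (darts M)"
    using permutes_in_funpow_image[OF premap_sig[OF M]] assms T(1) by (auto simp: Y_def)
  finally show ?thesis .
qed

lemma vertex_inj_R: "inj_on (vertex N) R"
proof (rule inj_onI)
  fix r r' assume r: "r \<in> R" "r' \<in> R" "vertex N r = vertex N r'"
  have "alp N r' \<in> T" using r(2) alp_mem by simp
  then have eq: "r' = alp N (alp M (alp M (alp N r')))" and m: "alp M (alp N r') \<in> T"
    using alpN alpM T(3) by simp_all
  from vertex_N_boundary[OF m] eq have "vertex N r' \<subseteq> insert r' (darts M)" by simp
  moreover have "r \<in> vertex N r'" using r(3) vertex_self[OF N, of r] by simp
  ultimately show "r = r'" using r(1) R_disj by auto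
qed

section \<open>Counts, connectedness and Euler's formula\<close>

lemma simple_boundary: "card T = 2 * m \<Longrightarrow> simple_boundary N m"
  unfolding simple_boundary_def Let_def face_root
  using card_R vertex_inj_R R_disj(2) by (simp add: alp_mem(1) del: image_iff)

lemma card_N: "card (darts N) = card (darts M) + card T"
  using card_Un_disjoint[OF finM finite_imageI[OF finT] disj] card_R by (simp add: darts)

lemma interior: "interior_edges N = (card (darts M) - card T) div 2"
proof -
  have "{d \<in> darts N. d \<notin> R \<and> alp N d \<notin> R} = darts M - T"
    using disj by (auto simp: darts alp_mem)
  then show ?thesis
    unfolding interior_edges_def face_root Let_def using card_Diff_subset[OF finT T(1)] by simp
qed

lemma nF_N: "nF N = nF M + 1"
proof -
  have f: "face N d = face M d" if "d \<in> darts M" for d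
    unfolding face_def using face_subset[OF M that] phi_eq
    by (intro orb_cong) (auto simp: face_def)
  have "face N r = R" if "r \<in> R" for r
    using that face_eq_iff[OF N, of r "root N"] face_root by simp
  then have "face N ` R = {R}" using T(2) by force
  then have eq: "face N ` darts N = insert R (face M ` darts M)"
    by (simp add: darts image_Un f cong: image_cong_simp)
  have "R \<notin> face M ` darts M"
  proof
    assume "R \<in> face M ` darts M"
    then obtain d where "d \<in> darts M" "R = face M d" by auto
    then show False using face_self[OF M, of d] R_disj by auto
  qed
  then show ?thesis unfolding nF_def eq using finM by simp
qed

text \<open>Vertices of \<open>M\<close> off the tree survive unchanged, and the vertices on the
  tree are replaced by one vertex per boundary dart. A vertex of \<open>N\<close> that meets
  \<open>T\<close> also meets the boundary, because \<open>sig N\<close> sends \<open>T\<close> into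
  it. The additive form avoids truncated subtraction.\<close>

lemma nV_N: "nV N + card (vertex M ` T) = nV M + card T"
proof -
  let ?UM = "{v\<in>vertex M ` darts M. v \<inter> T = {}}" and ?UN = "{v\<in>vertex N ` darts N. v \<inter> R = {}}"
  have TR: "v \<inter> T = {}" if "v \<in> ?UN" for v
  proof (rule ccontr)
    assume "v \<inter> T \<noteq> {}"
    then obtain d where d: "d \<in> v" "d \<in> T" by auto
    have "sig N d \<in> v" using that d(1) by (auto simp: vertex_def intro: orb_step)
    then show False using that sig_T[OF d(2)] by auto
  qed
  have "?UM = ?UN"
  proof
    show "?UM \<subseteq> ?UN"
    proof
      fix v assume v: "v \<in> ?UM"
      then obtain x where x: "x \<in> darts M" "v = orb (sig M) x" by (auto simp: vertex_def)
      have sub: "v \<subseteq> darts M" using vertex_subset[OF M x(1)] x(2) by (simp add: vertex_def)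
      have "orb (sig N) x = v"
        unfolding x(2) using sub v x(2) by (intro orb_cong sig_outside) auto
      then show "v \<in> ?UN" using x(1) sub disj by (auto simp: vertex_def darts)
    qed
    show "?UN \<subseteq> ?UM"
    proof
      fix v assume v: "v \<in> ?UN"
      then obtain x where x: "x \<in> darts N" "v = orb (sig N) x" by (auto simp: vertex_def)
      have sub: "v \<subseteq> darts M"
        using vertex_subset[OF N x(1)] x(2) v by (auto simp: vertex_def darts)
      have "orb (sig M) x = v"
        unfolding x(2) using sub TR[OF v] x(2) by (intro orb_cong sig_outside[symmetric]) auto
      moreover have "x \<in> darts M" using sub x(2) orb_self by blast
      ultimately show "v \<in> ?UM" using TR[OF v] by (auto simp: vertex_def)
    qed
  qed
  moreover have "card (vertex N ` R) = card T" using card_image[OF vertex_inj_R] card_R by simp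
  ultimately show ?thesis
    using nV_split[OF M T(1)] nV_split[OF N, of R] darts by simp
qed

text \<open>A closed set that touches the cut must contain all of \<open>T\<close>. In
  \<open>N\<close> the boundary cycle enforces this; in \<open>M\<close> there is no such cycle, and
  connectedness of the tree takes over, whence the assumption.\<close>

lemma is_map_N_iff:
  assumes "is_map A"
  shows "is_map N \<longleftrightarrow> is_map M"
proof
  assume mM: "is_map M"
  show "is_map N"
  proof (rule is_mapI[OF N])
    fix Y assume Y: "Y \<subseteq> darts N" "Y \<noteq> {}"
      "\<And>y. y \<in> Y \<Longrightarrow> sig N y \<in> Y" "\<And>y. y \<in> Y \<Longrightarrow> alp N y \<in> Y"
    have phiY: "phi N y \<in> Y" if "y \<in> Y" for y using that Y(3,4) by (simp add: phi_def)
    have phiM: "phi M y \<in> Y" if "y \<in> Y" "y \<in> darts M" for y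
      using phiY[OF that(1)] phi_eq[OF that(2)] by simp
    show "Y = darts N"
    proof (cases "Y \<inter> (T \<union> R) = {}")
      case False
      then obtain r where r: "r \<in> Y" "r \<in> R" using Y(4) alp_mem by blast
      have "orb (phi N) r = R"
        using face_eq_iff[OF N, of r "root N"] r(2) face_root by (simp add: face_def)
      then have RY: "R \<subseteq> Y" using orb_subsetI[of r Y "phi N"] r(1) phiY by auto
      then have TY: "T \<subseteq> Y" using Y(4) alpN by (metis image_subset_iff subsetI)
      have "Y \<inter> darts M = darts M"
      proof (rule is_map_closed_eq[OF mM])
        show a: "alp M y \<in> Y \<inter> darts M" if "y \<in> Y \<inter> darts M" for y
          using that TY T(3)[of y] Y(4)[of y] alp_eq[of y] premap_closed(2)[OF M, of y] by (cases "y \<in> T") auto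
        show "sig M y \<in> Y \<inter> darts M" if "y \<in> Y \<inter> darts M" for y
          using a[OF that] phiM premap_sig_eq[OF M, of y] premap_closed(3)[OF M] by auto
      qed (use TY T in auto)
      then show ?thesis using RY Y(1) darts by auto
    next
      case True
      then have sub: "Y \<subseteq> darts M" "Y \<inter> T = {}" using Y(1) darts by auto
      have "Y = darts M"
      proof (rule is_map_closed_eq[OF mM sub(1) Y(2)])
        show a: "alp M y \<in> Y" if "y \<in> Y" for y
          using that sub Y(4)[of y] alp_eq[of y] by (metis disjoint_iff subsetD)
        show "sig M y \<in> Y" if "y \<in> Y" for y
          using a[OF that] phiM premap_sig_eq[OF M, of y] sub(1) by auto
      qed
      then show ?thesis using sub T by auto
    qed
  qed
next
  assume mN: "is_map N"
  show "is_map M"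
  proof (rule is_mapI[OF M])
    fix Y assume Y: "Y \<subseteq> darts M" "Y \<noteq> {}"
      "\<And>y. y \<in> Y \<Longrightarrow> sig M y \<in> Y" "\<And>y. y \<in> Y \<Longrightarrow> alp M y \<in> Y"
    have phiY: "phi N y \<in> Y" if "y \<in> Y" for y
      using that Y(3)[OF Y(4)[OF that]] Y(1) phi_eq[of y] by (auto simp: phi_def)
    show "Y = darts M"
    proof (cases "Y \<inter> T = {}")
      case False
      have "Y \<inter> T = darts A"
      proof (rule is_map_closed_eq[OF assms])
        show "sig A y \<in> Y \<inter> T" if "y \<in> Y \<inter> T" for y
        proof -
          have "orb (sig M) y \<subseteq> Y" using orb_subsetI[of y Y "sig M"] that Y(3) by auto
          then show ?thesis
            using that first_return_in[OF premap_sig[OF M] finM, of y T] by auto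
        qed
      qed (use False Y(4) T(3) in auto)
      then have TY: "T \<subseteq> Y" by auto
      have "Y \<union> R = darts N"
      proof (rule is_map_closed_eq[OF mN])
        show a: "alp N y \<in> Y \<union> R" if "y \<in> Y \<union> R" for y
          using that TY Y(1,4) alp_eq[of y] alp_mem[of y] by (cases "y \<in> T") auto
        have "phi N y \<in> R" if "y \<in> R" for y
          using that orb_permutes_iff[OF premap_phi[OF N] finN, of y "root N"] face_root
          by (simp add: face_def)
        then show "sig N y \<in> Y \<union> R" if "y \<in> Y \<union> R" for y
          using a[OF that] phiY premap_sig_eq[OF N, of y] by auto
      qed (use Y darts in auto)
      then show ?thesis using Y(1) darts disj by auto
    next
      case True
      have "Y = darts N"
      proof (rule is_map_closed_eq[OF mN _ Y(2)])
        show a: "alp N y \<in> Y" if "y \<in> Y" for y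
          using that True Y(1) Y(4)[of y] alp_eq[of y] by (metis disjoint_iff subsetD)
        show "sig N y \<in> Y" if "y \<in> Y" for y
          using a[OF that] phiY premap_sig_eq[OF N, of y] by auto
      qed (use Y(1) darts in auto)
      then show ?thesis using Y(1) darts disj T(2) by auto
    qed
  qed
qed

text \<open>Edges grow by \<open>m\<close>, faces by 1 and vertices by 2m - (m + 1), so both sides
  of Euler's formula grow by \<open>m\<close>. The equivalence serves cutting in one direction and
  gluing in the other.\<close>

lemma TDM_iff_S:
  assumes "A \<in> PPT m"
  shows "(M, T) \<in> TDM e m \<longleftrightarrow> N \<in> S e m"
proof -
  have A': "is_map A" "nV A = m + 1" "card T div 2 = m"
    using assms by (auto simp: PPT_def planar_map_def nE_def)
  \<comment> \<open>\<open>nE\<close> halves with rounding, so evenness is needed to recover the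
    number of darts.\<close>
  have cT: "card T = 2 * m"
    using card_darts_even[OF A] dvd_mult_div_cancel[of 2 "card T"] A'(3) by simp
  have cV: "card (vertex M ` T) = m + 1" using A'(2) nV_induced[OF M T] by simp
  have tree: "tree_in M T" using A' by (simp add: tree_in_iff[OF M T] nE_def)
  have le: "card T \<le> card (darts M)" using T(1) finM card_mono by blast
  have nE: "nE N = nE M + m" using card_N cT by (simp add: nE_def)
  have int: "interior_edges N = nE M - m" using interior cT by (simp add: nE_def)
  have "m \<le> nE M" using le cT by (simp add: nE_def)
  then show ?thesis
    using nE int cT cV tree T(2) nF_N nV_N is_map_N_iff[OF A'(1)] simple_boundary
    unfolding TDM_def S_def planar_map_def by auto
qed

end

section \<open>Isomorphisms\<close>

text \<open>The witness that \<open>map_iso\<close> and \<open>tdm_iso\<close> quantify away, named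
  so that the image of the tree under it can be tracked.\<close>

definition is_iso :: "(nat \<Rightarrow> nat) \<Rightarrow> cmap \<Rightarrow> cmap \<Rightarrow> bool" where
  "is_iso f M M' \<longleftrightarrow> bij_betw f (darts M) (darts M') \<and>
     (\<forall>d\<in>darts M. f (sig M d) = sig M' (f d) \<and> f (alp M d) = alp M' (f d)) \<and>
     f (root M) = root M'"

lemma is_isoD:
  assumes "is_iso f M M'"
  shows "bij_betw f (darts M) (darts M')" "f ` darts M = darts M'" "inj_on f (darts M)"
    "\<And>d. d \<in> darts M \<Longrightarrow> f (sig M d) = sig M' (f d)"
    "\<And>d. d \<in> darts M \<Longrightarrow> f (alp M d) = alp M' (f d)" "f (root M) = root M'"
    "\<And>d. d \<in> darts M \<Longrightarrow> f d \<in> darts M'"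
  using assms by (auto simp: is_iso_def bij_betw_def)

lemma is_iso_phi:
  assumes "premap M" "is_iso f M M'" "d \<in> darts M"
  shows "f (phi M d) = phi M' (f d)"
  using assms is_isoD(4,5)[OF assms(2)] by (simp add: phi_def)

text \<open>Cuttings are specified by \<open>phi\<close> and \<open>alp\<close>, so isomorphisms
  between them are checked on these two; \<open>sig\<close> is their composite.\<close>

lemma is_isoI_phi:
  assumes M: "premap M" and M': "premap M'" and f: "bij_betw f (darts M) (darts M')"
    "\<And>d. d \<in> darts M \<Longrightarrow> f (alp M d) = alp M' (f d)"
    "\<And>d. d \<in> darts M \<Longrightarrow> f (phi M d) = phi M' (f d)" "f (root M) = root M'"
  shows "is_iso f M M'"
  unfolding is_iso_def
  using f premap_sig_eq[OF M] premap_sig_eq[OF M'] premap_closed[OF M] by simp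

lemma is_iso_id: "is_iso id M M"
  by (simp add: is_iso_def)

lemma is_iso_comp:
  assumes "is_iso f M M'" "is_iso g M' M''"
  shows "is_iso (g \<circ> f) M M''"
  using assms is_isoD(7)[OF assms(1)] bij_betw_trans unfolding is_iso_def by auto

lemma is_iso_inv:
  assumes "premap M" "is_iso f M M'"
  shows "is_iso (inv_into (darts M) f) M' M"
proof -
  note f = is_isoD[OF assms(2)]
  let ?g = "inv_into (darts M) f"
  have g: "?g (f d) = d" if "d \<in> darts M" for d using f(3) that by simp
  have "?g (sig M' d) = sig M (?g d) \<and> ?g (alp M' d) = alp M (?g d)" if "d \<in> darts M'" for d
  proof -
    have "d \<in> f ` darts M" using that by (simp only: f(2))
    then obtain x where x: "x \<in> darts M" "d = f x" by blast
    have "sig M x \<in> darts M" "alp M x \<in> darts M"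
      using x(1) premap_closed[OF assms(1)] by simp_all
    then show ?thesis
      unfolding x(2) f(4)[OF x(1), symmetric] f(5)[OF x(1), symmetric] using g x(1) by simp
  qed
  then show ?thesis
    using bij_betw_inv_into[OF f(1)] g[OF premap_root[OF assms(1)]] f(6) by (simp add: is_iso_def)
qed

lemma funpow_equivariant:
  assumes "p permutes D" "x \<in> D" "\<And>d. d \<in> D \<Longrightarrow> f (p d) = q (f d)"
  shows "f ((p ^^ n) x) = (q ^^ n) (f x)"
  by (induction n) (use assms permutes_in_funpow_image[OF assms(1,2)] in simp_all)

lemma orb_equivariant:
  assumes "p permutes D" "x \<in> D" "\<And>d. d \<in> D \<Longrightarrow> f (p d) = q (f d)"
  shows "orb q (f x) = f ` orb p x"
proof -
  have "(q ^^ n) (f x) = f ((p ^^ n) x)" for n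
    using funpow_equivariant[where f = f and q = q, OF assms] by simp
  then show ?thesis by (auto simp: orb_def)
qed

lemma card_orbits_equivariant:
  assumes "p permutes D" "inj_on f D" "\<And>d. d \<in> D \<Longrightarrow> f (p d) = q (f d)"
  shows "card (orb q ` f ` D) = card (orb p ` D)"
proof -
  have "orb q ` f ` D = image f ` orb p ` D"
    using orb_equivariant[where f = f and q = q, OF assms(1) _ assms(3)] by (simp add: image_image)
  moreover have "inj_on (image f) (orb p ` D)"
    using inj_on_image_Pow[OF assms(2)] orb_subset_permutes[OF assms(1)]
    by (auto intro: inj_on_subset)
  ultimately show ?thesis by (simp add: card_image)
qed

lemma is_iso_card:
  assumes M: "premap M" and f: "is_iso f M M'"
  shows "nV M' = nV M" "nF M' = nF M" "nE M' = nE M" "card (darts M') = card (darts M)"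
proof -
  note f' = is_isoD[OF f]
  show "nV M' = nV M"
    using card_orbits_equivariant[OF premap_sig[OF M] f'(3), of "sig M'"] f'(2,4)
    by (simp add: nV_def vertex_def[abs_def])
  show "nF M' = nF M"
    using card_orbits_equivariant[OF premap_phi[OF M] f'(3), of "phi M'"] f'(2) is_iso_phi[OF M f]
    by (simp add: nF_def face_def[abs_def])
  show "card (darts M') = card (darts M)" using bij_betw_same_card[OF f'(1)] by simp
  then show "nE M' = nE M" by (simp add: nE_def)
qed

text \<open>The preimage of a closed set is closed.\<close>

lemma is_iso_is_map:
  assumes M: "is_map M" and M': "premap M'" and f: "is_iso f M M'"
  shows "is_map M'"
proof (rule is_mapI[OF M'])
  note f' = is_isoD[OF f]
  fix Y assume Y: "Y \<subseteq> darts M'" "Y \<noteq> {}" "\<And>y. y \<in> Y \<Longrightarrow> sig M' y \<in> Y" "\<And>y. y \<in> Y \<Longrightarrow> alp M' y \<in> Y"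
  have "{x\<in>darts M. f x \<in> Y} = darts M"
  proof (rule is_map_closed_eq[OF M])
    obtain y where "y \<in> Y" using Y(2) by blast
    then have "y \<in> f ` darts M" using subsetD[OF Y(1)] by (simp only: f'(2))
    then show "{x\<in>darts M. f x \<in> Y} \<noteq> {}" using \<open>y \<in> Y\<close> by blast
    fix x assume "x \<in> {x\<in>darts M. f x \<in> Y}"
    then have x: "x \<in> darts M" "f x \<in> Y" by simp_all
    show "sig M x \<in> {x\<in>darts M. f x \<in> Y}"
      using x(1) Y(3)[OF x(2)] f'(4)[OF x(1)] premap_closed[OF is_map_premap[OF M]] by simp
    show "alp M x \<in> {x\<in>darts M. f x \<in> Y}"
      using x(1) Y(4)[OF x(2)] f'(5)[OF x(1)] premap_closed[OF is_map_premap[OF M]] by simp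
  qed simp
  then have "f ` darts M \<subseteq> Y" by blast
  then have "darts M' \<subseteq> Y" by (simp only: f'(2))
  with Y(1) show "Y = darts M'" by (rule equalityI)
qed

lemma is_iso_PPT:
  assumes "M \<in> PPT m" "premap M'" "is_iso f M M'"
  shows "M' \<in> PPT m"
  using assms is_iso_is_map[OF _ assms(2,3)] is_iso_card[OF _ assms(3)] is_map_premap
  by (auto simp: PPT_def planar_map_def)

section \<open>Existence of cuttings and gluings\<close>

lemma involution_permutes:
  assumes "\<And>d. d \<in> D \<Longrightarrow> a d \<in> D" "\<And>d. d \<in> D \<Longrightarrow> a (a d) = d" "\<And>d. d \<notin> D \<Longrightarrow> a d = d"
  shows "a permutes D"
  by (rule bij_imp_permutes) (use assms in \<open>auto intro!: bij_betw_byWitness[where f' = a]\<close>)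

lemma cut_exists:
  assumes M: "premap M" and T: "T \<subseteq> darts M" "root M \<in> T" "\<And>d. d \<in> T \<Longrightarrow> alp M d \<in> T"
    and single: "nF (induced M T) = 1"
  shows "\<exists>N. cutting M T N"
proof -
  let ?D = "darts M"
  let ?A = "induced M T"
  have A: "premap ?A" by (rule premap_induced[OF M T])
  \<comment> \<open>An upper bound for the darts of \<open>M\<close>: shifting \<open>T\<close> by
    \<open>K\<close> yields fresh darts for the boundary.\<close>
  obtain K where K: "\<And>d. d \<in> ?D \<Longrightarrow> d < K"
    using finite_nat_set_iff_bounded[THEN iffD1, OF premap_finite[OF M]] by blast
  let ?R = "(\<lambda>d. d + K) ` T"
  have R: "d \<notin> ?D" "d \<notin> T" if "d \<in> ?R" for d
    using K[of d] that T(1) by auto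
  have i: "inv (phi ?A) d \<in> T \<longleftrightarrow> d \<in> T" for d
    using permutes_in_image[OF permutes_inv[OF premap_phi[OF A]]] by simp
  define al where "al d = (if d \<in> T then d + K else if d \<in> ?D then alp M d else
     if d \<in> ?R then d - K else d)" for d
  define ph where "ph d = (if d \<in> ?D then phi M d else
     if d \<in> ?R then inv (phi ?A) (d - K) + K else d)" for d
  have al_T: "al d = d + K" if "d \<in> T" for d using that by (simp add: al_def)
  have al_R: "al (d + K) = d" if "d \<in> T" for d
    using that R[of "d + K"] by (auto simp: al_def)
  have al_D: "al d = alp M d" if "d \<in> ?D" "d \<notin> T" for d using that by (simp add: al_def)
  have alp_T: "alp M d \<in> T \<longleftrightarrow> d \<in> T" for d using T(3) premap_alp_alp[OF M] by metis
  have al_al: "al (al d) = d" for d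
  proof -
    consider "d \<in> T" | "d \<in> ?D" "d \<notin> T" | "d \<in> ?R" | "d \<notin> ?D" "d \<notin> ?R" by blast
    then show ?thesis
    proof cases
      case 2
      then show ?thesis using al_D[of d] al_D[of "alp M d"] alp_T premap_closed(2)[OF M] premap_alp_alp[OF M] by simp
    next
      case 4
      then have "d \<notin> T" using T(1) by blast
      with 4 have "al d = d" by (simp add: al_def)
      then show ?thesis by simp
    qed (auto simp: al_T al_R)
  qed
  have al_perm: "al permutes ?D \<union> ?R"
  proof (rule involution_permutes)
    fix d assume "d \<in> ?D \<union> ?R"
    then consider "d \<in> T" | "d \<in> ?D" "d \<notin> T" | x where "x \<in> T" "d = x + K" by auto
    then show "al d \<in> ?D \<union> ?R"
      using al_T al_R al_D premap_closed(2)[OF M] T(1) by cases auto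
  next
    fix d assume "d \<notin> ?D \<union> ?R"
    then have "d \<notin> T" "d \<notin> ?D" "d \<notin> ?R" using T(1) by auto
    then show "al d = d" by (simp add: al_def)
  qed (rule al_al)
  have ph_D: "ph d = phi M d" if "d \<in> ?D" for d using that by (simp add: ph_def)
  have ph_R: "ph (d + K) = inv (phi ?A) d + K" if "d \<in> T" for d
    using that R(1)[of "d + K"] by (simp add: ph_def)
  have ph_perm: "ph permutes ?D \<union> ?R"
  proof (rule inj_imp_permutes)
    show "inj_on ph (?D \<union> ?R)"
    proof (rule inj_onI)
      fix x y assume xy: "x \<in> ?D \<union> ?R" "y \<in> ?D \<union> ?R" "ph x = ph y"
      have D: "ph z \<in> ?D" if "z \<in> ?D" for z using that ph_D premap_closed(3)[OF M] by simp
      have nD: "ph z \<notin> ?D" if "z \<in> ?R" for z using that ph_R i R(1) by auto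
      consider "x \<in> ?D" "y \<in> ?D" | x' y' where "x' \<in> T" "y' \<in> T" "x = x' + K" "y = y' + K"
      proof -
        have "x \<in> ?D \<longleftrightarrow> y \<in> ?D" using xy(1,2) D[of x] D[of y] nD[of x] nD[of y] xy(3) by auto
        then show thesis using xy(1,2) that by blast
      qed
      then show "x = y"
      proof cases
        case 1
        then show ?thesis using xy(3) ph_D permutes_inj[OF premap_phi[OF M]] by (simp add: inj_eq)
      next
        case 2
        then have "inv (phi ?A) x' = inv (phi ?A) y'" using xy(3) ph_R by simp
        then show ?thesis
          using 2 permutes_inj[OF permutes_inv[OF premap_phi[OF A]]] by (simp add: inj_eq)
      qed
    qed
    show "finite (?D \<union> ?R)" using premap_finite[OF M] premap_finite[OF A] by simp
    show "ph d \<in> ?D \<union> ?R" if "d \<in> ?D \<union> ?R" for d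
      using that ph_D ph_R i premap_closed(3)[OF M] by auto
  qed (simp add: ph_def)
  \<comment> \<open>With \<open>al\<close> an involution, this choice of \<open>sig\<close> is the
    one that makes \<open>phi N\<close> equal to \<open>ph\<close>.\<close>
  define N where "N = \<lparr>darts = ?D \<union> ?R, sig = ph \<circ> al, alp = al, root = root M + K\<rparr>"
  have N: "darts N = ?D \<union> ?R" "alp N = al" "root N = root M + K" "phi N = ph"
    by (auto simp: N_def phi_def al_al)
  have RN: "alp N ` T = ?R" using al_T by (simp add: N)
  have al_neq: "al d \<noteq> d" if d: "d \<in> ?D \<union> ?R" for d
  proof -
    consider "d \<in> T" | "d \<in> ?D" "d \<notin> T" | x where "x \<in> T" "d = x + K" using d by auto
    then show ?thesis
      using al_T al_R al_D premap_alp_neq[OF M] R(2)[of d] K T(1) by cases fastforce+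
  qed
  have "premap N"
    unfolding premap_def using premap_finite[OF M] premap_finite[OF A] T(2) al_neq al_al
      permutes_compose[OF al_perm ph_perm] al_perm by (auto simp: N_def)
  then have "cutting M T N"
  proof unfold_locales
    show "darts M \<inter> alp N ` T = {}" unfolding RN using R by blast
    show "phi N (alp N (phi (induced M T) d)) = alp N d" if "d \<in> T" for d
    proof -
      have "phi ?A d \<in> T" using that premap_closed(3)[OF A, of d] by simp
      then show ?thesis
        using that al_T ph_R permutes_inverses(2)[OF premap_phi[OF A]] by (simp add: N)
    qed
  qed (use M T single RN in \<open>simp_all add: N al_D ph_D al_T\<close>)
  then show ?thesis by blast
qed

text \<open>The contour of the plane tree and the inverse of the boundary face of \<open>N\<close> are cycles of the same
  length; \<open>b\<close> identifies them root to root. Since the boundary is simple, each of its vertices carries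
  a single boundary dart, so the first return of \<open>sig M\<close> to the glued tree is the rotation of \<open>A\<close>.\<close>

lemma glue_exists:
  assumes N: "premap N" and A: "premap A" "nF A = 1" "card (darts A) = 2 * m"
    and bd: "simple_boundary N m"
  shows "\<exists>M T c. cutting M T N \<and> is_iso c A (induced M T)"
proof -
  define R where "R = face N (root N)"
  have R: "card R = 2 * m" "inj_on (vertex N) R" "\<And>d. d \<in> R \<Longrightarrow> alp N d \<notin> R"
    using bd unfolding simple_boundary_def Let_def R_def by blast+
  have RN: "R \<subseteq> darts N" unfolding R_def by (rule face_subset[OF N premap_root[OF N]])
  have phiR: "phi N d \<in> R \<longleftrightarrow> d \<in> R" for d
    unfolding R_def face_def by (rule orb_permutes_iff[OF premap_phi[OF N] premap_finite[OF N]])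
  have "orb (phi A) (root A) = darts A" using nF_eq_1_iff[OF A(1)] A(2) by (simp add: face_def)
  moreover have "orb (inv (phi N)) (root N) = R"
    using orb_inv[OF premap_phi[OF N] premap_finite[OF N]] by (simp add: R_def face_def)
  \<comment> \<open>The inverse of \<open>phi N\<close> appears because the boundary must be read
    against the contour.\<close>
  ultimately obtain b where b: "bij_betw b (darts A) R" "b (root A) = root N"
      "\<And>a. a \<in> darts A \<Longrightarrow> b (phi A a) = inv (phi N) (b a)"
    using orb_bij_equivariant[OF premap_phi[OF A(1)] premap_finite[OF A(1)] premap_root[OF A(1)]
        permutes_inv[OF premap_phi[OF N]] premap_finite[OF N] premap_root[OF N]] R(1) A(3)
    by (metis (no_types, lifting))
  \<comment> \<open>The boundary darts disappear in the gluing, so a tree dart is represented by the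
    dart across its boundary edge. These inner sides form \<open>T\<close>.\<close>
  define c where "c = alp N \<circ> b"
  define T where "T = alp N ` R"
  define D where "D = darts N - R"
  have bR: "b a \<in> R" if "a \<in> darts A" for a using b(1) that by (auto simp: bij_betw_def)
  have c: "bij_betw c (darts A) T"
    unfolding c_def T_def
    by (rule bij_betw_trans[OF b(1)])
      (simp add: bij_betw_def permutes_inj_on[OF premap_alp[OF N]])
  have cT: "c a \<in> T" if "a \<in> darts A" for a using c that by (auto simp: bij_betw_def)
  have c_inj: "inj_on c (darts A)" using c by (simp add: bij_betw_def)
  have alp_c: "alp N (c a) = b a" for a by (simp add: c_def premap_alp_alp[OF N])
  have phi_c: "phi N (alp N (c (phi A a))) = alp N (c a)" if "a \<in> darts A" for a
    using that b(3) by (simp add: alp_c permutes_inverses(1)[OF premap_phi[OF N]])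
  have T_iff: "alp N d \<in> R \<longleftrightarrow> d \<in> T" for d
    unfolding T_def by (metis image_iff premap_alp_alp[OF N])
  have TR: "d \<notin> R" if "d \<in> T" for d using that R(3) by (auto simp: T_def)
  have TD: "T \<subseteq> D" using TR RN premap_closed(2)[OF N] by (auto simp: D_def T_def)
  \<comment> \<open>The gluing itself: two inner sides become one edge exactly when the
    corresponding darts of \<open>A\<close> do.\<close>
  define al where "al d = (if d \<in> T then c (alp A (inv_into (darts A) c d))
     else if d \<in> D then alp N d else d)" for d
  define ph where "ph d = (if d \<in> D then phi N d else d)" for d
  have al_c: "al (c a) = c (alp A a)" if "a \<in> darts A" for a
    using that cT c_inj by (simp add: al_def)
  have al_D: "al d = alp N d" if "d \<in> D" "d \<notin> T" for d using that by (simp add: al_def)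
  have alp_D: "alp N d \<in> D \<and> alp N d \<notin> T" if "d \<in> D" "d \<notin> T" for d
    using that T_iff[of d] T_iff[of "alp N d"] premap_closed(2)[OF N] premap_alp_alp[OF N]
    by (auto simp: D_def)
  have al: "al d \<in> D \<and> al (al d) = d \<and> al d \<noteq> d" if d: "d \<in> D" for d
  proof -
    consider a where "a \<in> darts A" "d = c a" | "d \<notin> T"
      using c by (auto simp: bij_betw_def)
    then show ?thesis
    proof cases
      case (1 a)
      have aa: "alp A a \<in> darts A" using 1 premap_closed(2)[OF A(1)] by simp
      have "c (alp A a) \<noteq> c a"
        using c_inj aa 1(1) premap_alp_neq[OF A(1)] by (metis inj_onD)
      then show ?thesis using 1 aa al_c cT TD premap_alp_alp[OF A(1)] by auto
    next
      case 2
      then show ?thesis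
        using d al_D alp_D[OF d] premap_alp_alp[OF N] premap_alp_neq[OF N] D_def by auto
    qed
  qed
  have al_perm: "al permutes D"
    by (rule involution_permutes) (use al TD in \<open>auto simp: al_def\<close>)
  have phD: "ph d \<in> D" if "d \<in> D" for d
    using that phiR premap_closed(3)[OF N] by (simp add: ph_def D_def)
  have ph_perm: "ph permutes D"
  proof (rule inj_imp_permutes)
    show "inj_on ph D"
      using permutes_inj_on[OF premap_phi[OF N], of D] by (simp add: inj_on_def ph_def)
    show "finite D" using premap_finite[OF N] by (simp add: D_def)
  qed (use phD in \<open>auto simp: ph_def\<close>)
  define M where "M = \<lparr>darts = D, sig = ph \<circ> al, alp = al, root = alp N (root N)\<rparr>"
  have al_al: "al (al d) = d" for d
    using al[of d] TD by (cases "d \<in> D") (auto simp: al_def)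
  have M: "darts M = D" "alp M = al" "root M = alp N (root N)" "phi M = ph"
    by (auto simp: M_def phi_def al_al)
  have rootT: "root M \<in> T" by (simp add: M T_def R_def face_self[OF N])
  have pM: "premap M"
    unfolding premap_def using al al_perm permutes_compose[OF al_perm ph_perm]
      premap_finite[OF N] rootT TD by (auto simp: M_def D_def)
  have sig_c: "sig M (c a) = sig N (b (alp A a))" if "a \<in> darts A" for a
  proof -
    have "c (alp A a) \<in> D" using that cT[of "alp A a"] premap_closed(2)[OF A(1)] TD by auto
    then have "sig M (c a) = phi N (c (alp A a))" using al_c[OF that] by (simp add: M_def ph_def)
    also have "\<dots> = sig N (b (alp A a))"
      using premap_sig_eq[OF N, of "b (alp A a)"] alp_c[of "alp A a"] premap_alp_alp[OF N]
      by (metis)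
    finally show ?thesis .
  qed
  have sig_D: "sig M d = sig N d" if "d \<in> D" "d \<notin> T" for d
    using that alp_D[OF that] premap_sig_eq[OF N] by (simp add: M_def al_D ph_def)
  have sig_T: "sig N d \<in> R" if "d \<in> T" for d
    using that premap_sig_eq[OF N, of d] phiR T_iff by simp
  have ret: "first_return (sig M) T (c a) = c (sig A a)" if a: "a \<in> darts A" for a
  proof -
    define r where "r = b (alp A a)"
    let ?s = "\<lambda>j. (sig N ^^ j) r"
    have aa: "alp A a \<in> darts A" using a premap_closed(2)[OF A(1)] by simp
    have rR: "r \<in> R" using bR[OF aa] by (simp add: r_def)
    then have rN: "r \<in> darts N" using RN by blast
    \<comment> \<open>The degree of the boundary vertex at \<open>r\<close>; the return time will be
      \<open>n - 1\<close>, as the boundary dart \<open>r\<close> is removed.\<close>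
    define n where "n = card (orb (sig N) r)"
    have n: "?s n = r" "inj_on ?s {..<n}"
      using orb_enum[OF premap_sig[OF N] premap_finite[OF N] rN] by (auto simp: n_def bij_betw_def)
    have t: "sig N (c (sig A a)) = r"
    proof -
      have "sig N (c (sig A a)) = phi N (alp N (c (phi A (alp A a))))"
        using premap_sig_eq[OF N] premap_sig_eq[OF A(1)] by simp
      also have "\<dots> = r" using phi_c[OF aa] by (simp add: alp_c r_def)
      finally show ?thesis .
    qed
    have tT: "c (sig A a) \<in> T" using cT premap_closed(1)[OF A(1)] a by simp
    have inj: "x = y" if "sig N x = sig N y" for x y
      using that permutes_inj[OF premap_sig[OF N]] by (simp add: inj_eq)
    have "n \<noteq> 0"
      using orb_self[of r "sig N"] finite_subset[OF orb_subset_permutes[OF premap_sig[OF N] rN] premap_finite[OF N]]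
      by (metis card_eq_0_iff empty_iff n_def)
    \<comment> \<open>The predecessor of \<open>r\<close> is in \<open>T\<close>, hence not on the
      boundary and different from \<open>r\<close>. This makes the return time positive.\<close>
    moreover have "n \<noteq> 1"
    proof
      assume "n = 1"
      then have "sig N r = sig N (c (sig A a))" using n(1) t by simp
      then show False using inj tT TR rR by blast
    qed
    ultimately have n2: "n \<ge> 2" by linarith
    have "sig N (?s (n - 1)) = ?s n" using n2 by (cases n) simp_all
    then have last: "?s (n - 1) = c (sig A a)" using n(1) t inj by metis
    have notR: "?s j \<notin> R" if "0 < j" "j < n" for j
    proof
      assume "?s j \<in> R"
      moreover have "vertex N (?s j) = vertex N r"
        using vertex_eq_iff[OF N] funpow_in_orb[of j "sig N" r] by (simp add: vertex_def)
      ultimately have "?s j = ?s 0" using R(2) rR by (auto dest: inj_onD)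
      then show False using inj_onD[OF n(2), of j 0] that by simp
    qed
    \<comment> \<open>A dart of \<open>T\<close> is followed under \<open>sig N\<close> by a
      boundary dart, and the only one at this vertex is \<open>r\<close>. So a tree dart can only be
      the last one before \<open>r\<close>.\<close>
    have notT: "?s j \<notin> T" if "0 < j" "j < n - 1" for j
      using notR[of "Suc j"] sig_T[of "?s j"] that by auto
    have sN: "?s j \<in> darts N" for j
      using permutes_in_funpow_image[OF premap_sig[OF N] rN] .
    \<comment> \<open>The two sequences start at different darts, \<open>c a\<close> and
      \<open>r\<close>, but \<open>sig M (c a) = sig N r\<close>; from there the rotations agree
      until the next tree dart is reached.\<close>
    have eq: "(sig M ^^ Suc j) (c a) = ?s (Suc j)" if "Suc j < n" for j
      using that
    proof (induction j)
      case 0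
      then show ?case using sig_c[OF a] by (simp add: r_def)
    next
      case (Suc j)
      have "?s (Suc j) \<in> D" "?s (Suc j) \<notin> T"
        using notR[of "Suc j"] notT[of "Suc j"] Suc.prems sN[of "Suc j"] by (auto simp: D_def)
      then have "sig M (?s (Suc j)) = sig N (?s (Suc j))" by (rule sig_D)
      moreover have "(sig M ^^ Suc j) (c a) = ?s (Suc j)" using Suc by simp
      ultimately show ?case by (metis comp_apply funpow.simps(2))
    qed
    have eq': "(sig M ^^ j) (c a) = ?s j" if "0 < j" "j < n" for j
      using eq[of "j - 1"] that by simp
    have "first_return (sig M) T (c a) = (sig M ^^ (n - 1)) (c a)"
      by (rule first_return_eqI) (use n2 eq' last tT notT in auto)
    then show ?thesis using eq'[of "n - 1"] n2 last by simp
  qed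
  have alT: "alp M d \<in> T" if "d \<in> T" for d
    using that c al_c cT premap_closed(2)[OF A(1)] by (auto simp: M bij_betw_def)
  have iso: "is_iso c A (induced M T)"
    unfolding is_iso_def using c ret al_c cT b(2) by (simp add: M) (simp add: c_def)
  have TM: "T \<subseteq> darts M" using TD by (simp add: M)
  have altT: "alp N ` T = R"
    using T_iff by (auto simp: T_def premap_alp_alp[OF N] image_iff)
  have "cutting M T N"
  proof unfold_locales
    show "darts M \<inter> alp N ` T = {}" by (auto simp: altT M D_def)
    show "darts N = darts M \<union> alp N ` T" using RN by (auto simp: altT M D_def)
    show "phi N (alp N (phi (induced M T) d)) = alp N d" if "d \<in> T" for d
    proof -
      obtain a where a: "a \<in> darts A" "d = c a" using \<open>d \<in> T\<close> c by (auto simp: bij_betw_def)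
      then show ?thesis using is_iso_phi[OF A(1) iso a(1)] phi_c[OF a(1)] by simp
    qed
    show "nF (induced M T) = 1" using is_iso_card(2)[OF A(1) iso] A(2) by simp
    show "root N = alp N (root M)" by (simp add: M premap_alp_alp[OF N])
  qed (use N pM TM rootT alT in \<open>simp_all add: M al_D ph_def\<close>)
  then show ?thesis using iso by blast
qed

section \<open>Cutting respects isomorphism\<close>

text \<open>As \<open>f\<close> respects membership in the trees along every rotation, return times
  are the same on both sides.\<close>

lemma is_iso_induced:
  assumes M: "premap M" and f: "is_iso f M M'" "f ` T = T'"
    and T: "T \<subseteq> darts M" "\<And>d. d \<in> T \<Longrightarrow> alp M d \<in> T"
  shows "is_iso f (induced M T) (induced M' T')"
proof -
  note f' = is_isoD[OF f(1)]
  have mem: "f d \<in> T' \<longleftrightarrow> d \<in> T" if "d \<in> darts M" for d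
    using inj_on_image_mem_iff[OF f'(3) that T(1)] f(2) by simp
  have "bij_betw f T T'"
    using inj_on_subset[OF f'(3) T(1)] f(2) by (simp add: bij_betw_def)
  moreover have "f (sig (induced M T) d) = sig (induced M' T') (f d)" if d: "d \<in> T" for d
  proof -
    have dM: "d \<in> darts M" using d T(1) by blast
    have pow: "(sig M' ^^ k) (f d) = f ((sig M ^^ k) d)" for k
      using funpow_equivariant[where f = f and q = "sig M'", OF premap_sig[OF M] dM f'(4)] by simp
    have "(sig M ^^ k) d \<in> darts M" for k
      by (rule permutes_in_funpow_image[OF premap_sig[OF M] dM])
    then have "first_return (sig M') T' (f d) = f (first_return (sig M) T d)"
      by (simp add: first_return_def pow mem)
    then show ?thesis using d mem[OF dM] by simp
  qed
  moreover have "f (alp (induced M T) d) = alp (induced M' T') (f d)" if d: "d \<in> T" for d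
  proof -
    have dM: "d \<in> darts M" using d T(1) by blast
    then show ?thesis using d mem[OF dM] f'(5) by simp
  qed
  ultimately show ?thesis using f'(6) by (simp add: is_iso_def)
qed

text \<open>On the old darts take \<open>f\<close>; the new darts of the two cuts may be unrelated
  and are matched through the tree darts opposite to them. With \<open>f = id\<close> this says that
  a cut is unique up to isomorphism.\<close>

lemma cutting_iso:
  assumes c: "cutting M T N" and c': "cutting M' T' N'" and f: "is_iso f M M'" "f ` T = T'"
  shows "\<exists>h. is_iso h N N'"
proof -
  interpret cutting M T N by (rule c)
  interpret C': cutting M' T' N' by (rule c')
  note f' = is_isoD[OF f(1)]
  define h where "h d = (if d \<in> darts M then f d else alp N' (f (alp N d)))" for d
  have h_D: "h d = f d" if "d \<in> darts M" for d using that by (simp add: h_def)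
  have h_T: "h d = f d" if "d \<in> T" for d using that T(1) h_D by blast
  have h_R: "h (alp N t) = alp N' (f t)" if "t \<in> T" for t
    using R_disj(1)[of "alp N t"] that by (simp add: h_def alpN)
  have mem: "f d \<in> T' \<longleftrightarrow> d \<in> T" if "d \<in> darts M" for d
    using inj_on_image_mem_iff[OF f'(3) that T(1)] f(2) by simp
  have fA: "is_iso f A C'.A" by (rule is_iso_induced[OF M f T(1,3)])
  have "is_iso h N N'"
  proof (rule is_isoI_phi[OF N C'.N])
    have D: "bij_betw h (darts M) (darts M')"
      using f'(1) h_D by (simp cong: bij_betw_cong)
    have T: "bij_betw f T T'"
      using inj_on_subset[OF f'(3) T(1)] f(2) by (simp add: bij_betw_def)
    have "bij_betw (alp N) R T"
      by (rule bij_betw_byWitness[where f' = "alp N"]) (auto simp: alpN)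
    moreover have "bij_betw (alp N') T' C'.R"
      by (simp add: bij_betw_def permutes_inj_on[OF premap_alp[OF C'.N]])
    ultimately have "bij_betw (alp N' \<circ> f \<circ> alp N) R C'.R"
      using T bij_betw_trans by blast
    moreover have "h d = (alp N' \<circ> f \<circ> alp N) d" if "d \<in> R" for d
      using that R_disj(1) by (simp add: h_def)
    ultimately have "bij_betw h R C'.R"
      using bij_betw_cong[of R h "alp N' \<circ> f \<circ> alp N" C'.R] by blast
    then show "bij_betw h (darts N) (darts N')"
      unfolding darts C'.darts using bij_betw_combine[OF D] C'.disj by blast
  next
    fix d assume "d \<in> darts N"
    then consider "d \<in> T" | "d \<in> darts M" "d \<notin> T" | t where "t \<in> T" "d = alp N t"
      using darts by blast
    then show "h (alp N d) = alp N' (h d)"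
    proof cases
      case 1
      then show ?thesis using h_R h_T by simp
    next
      case 2
      then have "f d \<in> darts M'" "f d \<notin> T'" using f'(7) mem by simp_all
      then show ?thesis
        using 2 alp_eq[of d] C'.alp_eq[of "f d"] h_D f'(5) premap_closed(2)[OF M] by simp
    next
      case 3
      then show ?thesis using h_T h_R alpN C'.alpN by simp
    qed
  next
    fix d assume "d \<in> darts N"
    then consider "d \<in> darts M" | t where "t \<in> T" "d = alp N t"
      using darts by blast
    then show "h (phi N d) = phi N' (h d)"
    proof cases
      case 1
      then show ?thesis
        using phi_eq C'.phi_eq[OF f'(7)[OF 1]] h_D is_iso_phi[OF M f(1)] premap_closed(3)[OF M] by simp
    next
      case 2
      \<comment> \<open>The dart before \<open>t\<close> on the contour, so that
        \<open>alp N s\<close> comes after \<open>alp N t\<close> on the boundary.\<close>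
      define s where "s = inv (phi A) t"
      have s: "s \<in> T" "t = phi A s"
        using permutes_in_image[OF permutes_inv[OF premap_phi[OF A]], of t] 2(1)
          permutes_inverses(1)[OF premap_phi[OF A]] by (simp_all add: s_def)
      have "f s \<in> T'" using s(1) f(2) by blast
      then have "phi N' (alp N' (phi C'.A (f s))) = alp N' (f s)" by (rule C'.phi_boundary)
      moreover have "f t = phi C'.A (f s)" using is_iso_phi[OF A fA, of s] s by simp
      ultimately have "phi N' (h d) = alp N' (f s)" using h_R[OF 2(1)] 2(2) by simp
      moreover have "phi N d = alp N s" using phi_boundary[OF s(1)] s(2) 2(2) by simp
      ultimately show ?thesis using h_R[OF s(1)] by simp
    qed
  next
    show "h (root N) = root N'" using h_R[OF T(2)] f'(6) by (simp add: root C'.root)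
  qed
  then show ?thesis by blast
qed

text \<open>Starting at the root, \<open>h\<close> is forced to follow \<open>g\<close> along the
  boundary, hence also on \<open>T\<close>. There \<open>g\<close> shows that the edge pairing of
  \<open>M\<close> is respected, which \<open>h\<close> alone cannot know; off \<open>T\<close> the
  pairing is that of \<open>N\<close>.\<close>

lemma cutting_iso_converse:
  assumes c: "cutting M T N" and c': "cutting M' T' N'"
    and g: "is_iso g (induced M T) (induced M' T')" and h: "is_iso h N N'"
  shows "is_iso h M M'" "h ` T = T'"
proof -
  interpret cutting M T N by (rule c)
  interpret C': cutting M' T' N' by (rule c')
  note h' = is_isoD[OF h] and g' = is_isoD[OF g, simplified]
  have R: "d \<in> T \<and> h (alp N d) = alp N' (g d)" if "d \<in> orb (phi A) (root M)" for d
    using that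
  proof (induction rule: orb_induct)
    case self
    then show ?case using T(2) h'(6) g'(6) by (simp add: root C'.root)
  next
    case (step d)
    then have d: "d \<in> T" "h (alp N d) = alp N' (g d)" by simp_all
    have pd: "phi A d \<in> T" by (rule phi_induced_in[OF d(1)])
    then have "alp N (phi A d) \<in> darts N" using darts by blast
    \<comment> \<open>One step forward on the contour is one step backward on the boundary, so the
      claim for \<open>phi A d\<close> follows by cancelling the injective
      \<open>phi N'\<close>.\<close>
    then have "phi N' (h (alp N (phi A d))) = h (alp N d)"
      using is_iso_phi[OF N h, of "alp N (phi A d)"] phi_boundary[OF d(1)] by simp
    also have "\<dots> = phi N' (alp N' (phi C'.A (g d)))"
      using d C'.phi_boundary[OF g'(7)[OF d(1)]] by simp
    also have "\<dots> = phi N' (alp N' (g (phi A d)))"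
      using is_iso_phi[OF A g] d(1) by simp
    finally show ?case
      using pd permutes_inj[OF premap_phi[OF C'.N]] by (simp add: inj_eq)
  qed
  have h_R: "h (alp N d) = alp N' (g d)" if "d \<in> T" for d using R[of d] contour that by simp
  have h_T: "h d = g d" if "d \<in> T" for d
  proof -
    have "alp N d \<in> darts N" using that darts by blast
    then have "h (alp N (alp N d)) = alp N' (h (alp N d))" by (rule h'(5))
    then show ?thesis using h_R[OF that] alpN C'.alpN by simp
  qed
  show hT: "h ` T = T'" using h_T g'(2) by (simp cong: image_cong)
  have hR: "h ` R = C'.R"
  proof -
    have "h ` alp N ` T = alp N' ` g ` T"
      unfolding image_image by (rule image_cong) (simp_all add: h_R)
    then show ?thesis by (simp only: g'(2))
  qed
  have inj: "inj_on h (darts M \<union> R)" using h'(3) darts by simp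
  have hN: "h ` (darts M \<union> R) = darts M' \<union> C'.R"
    using h'(2) darts C'.darts by simp
  have "darts M = (darts M \<union> R) - R" using disj by blast
  then have "h ` darts M = h ` ((darts M \<union> R) - R)" by simp
  also have "\<dots> = (darts M' \<union> C'.R) - C'.R"
    by (simp only: inj_on_image_set_diff[OF inj Diff_subset Un_upper2] hN hR)
  also have "\<dots> = darts M'" using C'.disj by blast
  finally have hD: "h ` darts M = darts M'" .
  have mem: "h d \<in> T' \<longleftrightarrow> d \<in> T" if "d \<in> darts M" for d
    using inj_on_image_mem_iff[OF h'(3), of d T] that hT darts T(1) by auto
  show "is_iso h M M'"
  proof (rule is_isoI_phi[OF M C'.M])
    show "bij_betw h (darts M) (darts M')"
      using hD inj_on_subset[OF inj] by (simp add: bij_betw_def)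
    fix d assume d: "d \<in> darts M"
    then have dN: "d \<in> darts N" and d': "h d \<in> darts M'" using darts hD by blast+
    show "h (alp M d) = alp M' (h d)"
    proof (cases "d \<in> T")
      case True
      then show ?thesis using h_T T(3) g'(5)[of d] g'(7)[of d] by simp
    next
      case False
      then show ?thesis using mem[OF d] alp_eq[OF d] C'.alp_eq[OF d'] h'(5)[OF dN] by simp
    qed
    show "h (phi M d) = phi M' (h d)"
      using phi_eq[OF d] C'.phi_eq[OF d'] is_iso_phi[OF N h dN] by simp
  next
    show "h (root M) = root M'" using h_T[OF T(2)] g'(6) by simp
  qed
qed

section \<open>The bijection\<close>

text \<open>Of the equivalence \<open>rel\<close>, one direction makes the map independent of the
  chosen representative and the other makes it injective, so no inverse function is needed.\<close>

lemma quotient_product_bij: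
  assumes eq: "equiv A r" "equiv B s" "equiv C t"
    and fg: "\<And>x. x \<in> A \<Longrightarrow> f x \<in> B" "\<And>x. x \<in> A \<Longrightarrow> g x \<in> C"
    and rel: "\<And>x y. x \<in> A \<Longrightarrow> y \<in> A \<Longrightarrow> (x, y) \<in> r \<longleftrightarrow> (f x, f y) \<in> s \<and> (g x, g y) \<in> t"
    and surj: "\<And>b c. b \<in> B \<Longrightarrow> c \<in> C \<Longrightarrow> \<exists>x\<in>A. (f x, b) \<in> s \<and> (g x, c) \<in> t"
  shows "\<exists>\<Phi>. bij_betw \<Phi> (A // r) ((B // s) \<times> (C // t)) \<and> (\<forall>x\<in>A. fst (\<Phi> (r `` {x})) = s `` {f x})"
proof -
  define \<Phi> where "\<Phi> X = (s `` {f (SOME x. x \<in> X)}, t `` {g (SOME x. x \<in> X)})" for X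
  have \<Phi>: "\<Phi> (r `` {x}) = (s `` {f x}, t `` {g x})" if x: "x \<in> A" for x
  proof -
    have "x \<in> r `` {x}" using equiv_class_self[OF eq(1) x] .
    then have "(SOME y. y \<in> r `` {x}) \<in> r `` {x}" by (rule someI)
    then obtain y where y: "(SOME y. y \<in> r `` {x}) = y" "(x, y) \<in> r" by blast
    then have "y \<in> A" using equiv_class_eq_iff[OF eq(1)] by blast
    then have "(f x, f y) \<in> s" "(g x, g y) \<in> t" using rel[OF x] y(2) by simp_all
    then show ?thesis
      using equiv_class_eq[OF eq(2)] equiv_class_eq[OF eq(3)] unfolding \<Phi>_def y(1) by simp
  qed
  have "bij_betw \<Phi> (A // r) ((B // s) \<times> (C // t))"
    unfolding bij_betw_def
  proof
    show "inj_on \<Phi> (A // r)"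
    proof (rule inj_onI)
      fix X Y assume XY: "X \<in> A // r" "Y \<in> A // r" "\<Phi> X = \<Phi> Y"
      obtain x where x: "x \<in> A" "X = r `` {x}" using XY(1) by (rule quotientE)
      obtain y where y: "y \<in> A" "Y = r `` {y}" using XY(2) by (rule quotientE)
      have "s `` {f x} = s `` {f y}" "t `` {g x} = t `` {g y}"
        using XY(3) \<Phi>[OF x(1)] \<Phi>[OF y(1)] x(2) y(2) by simp_all
      then have "(f x, f y) \<in> s" "(g x, g y) \<in> t"
        using eq_equiv_class[OF _ eq(2)] eq_equiv_class[OF _ eq(3)] fg y(1) by blast+
      then have "(x, y) \<in> r" using rel[OF x(1) y(1)] by simp
      then show "X = Y" using equiv_class_eq[OF eq(1)] x(2) y(2) by simp
    qed
    show "\<Phi> ` (A // r) = (B // s) \<times> (C // t)"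
    proof
      show "\<Phi> ` (A // r) \<subseteq> (B // s) \<times> (C // t)"
      proof
        fix z assume "z \<in> \<Phi> ` (A // r)"
        then obtain X where X: "X \<in> A // r" "z = \<Phi> X" by blast
        obtain x where x: "x \<in> A" "X = r `` {x}" using X(1) by (rule quotientE)
        then have "z = (s `` {f x}, t `` {g x})" using \<Phi> X(2) by simp
        then show "z \<in> (B // s) \<times> (C // t)" using fg[OF x(1)] by (simp add: quotientI)
      qed
      show "(B // s) \<times> (C // t) \<subseteq> \<Phi> ` (A // r)"
      proof
        fix z assume "z \<in> (B // s) \<times> (C // t)"
        then obtain P Q where z: "z = (P, Q)" "P \<in> B // s" "Q \<in> C // t" by blast
        obtain b where b: "b \<in> B" "P = s `` {b}" using z(2) by (rule quotientE)
        obtain c where c: "c \<in> C" "Q = t `` {c}" using z(3) by (rule quotientE)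
        obtain x where x: "x \<in> A" "(f x, b) \<in> s" "(g x, c) \<in> t" using surj[OF b(1) c(1)] by blast
        then have "\<Phi> (r `` {x}) = z"
          using \<Phi> equiv_class_eq[OF eq(2)] equiv_class_eq[OF eq(3)] z(1) b(2) c(2) by simp
        then show "z \<in> \<Phi> ` (A // r)" using quotientI[OF x(1)] by blast
      qed
    qed
  qed
  then show ?thesis using \<Phi> by auto
qed

lemma map_iso_iff: "map_iso M M' \<longleftrightarrow> (\<exists>f. is_iso f M M')"
  by (simp add: map_iso_def is_iso_def)

lemma tdm_iso_iff: "tdm_iso (M, T) (M', T') \<longleftrightarrow> (\<exists>f. is_iso f M M' \<and> f ` T = T')"
  by (simp add: tdm_iso_def is_iso_def conj_assoc)

lemma equiv_map_iso_rel:
  assumes "\<And>M. M \<in> X \<Longrightarrow> premap M"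
  shows "equiv X (map_iso_rel X)"
proof (rule equivI)
  show "refl_on X (map_iso_rel X)"
    using is_iso_id by (auto simp: refl_on_def map_iso_rel_def map_iso_iff)
  show "sym (map_iso_rel X)"
    using is_iso_inv assms by (auto simp: sym_def map_iso_rel_def map_iso_iff) blast
  show "trans (map_iso_rel X)"
    using is_iso_comp by (auto simp: trans_def map_iso_rel_def map_iso_iff) blast
qed (auto simp: map_iso_rel_def)

lemma equiv_tdm_iso_rel:
  assumes "\<And>M T. (M, T) \<in> X \<Longrightarrow> premap M \<and> T \<subseteq> darts M"
  shows "equiv X (tdm_iso_rel X)"
proof (rule equivI)
  show "refl_on X (tdm_iso_rel X)"
    using is_iso_id by (auto simp: refl_on_def tdm_iso_rel_def tdm_iso_iff intro!: exI[of _ id])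
  show "sym (tdm_iso_rel X)"
  proof (rule symI)
    fix x y assume "(x, y) \<in> tdm_iso_rel X"
    moreover obtain M T where x: "x = (M, T)" by fastforce
    moreover obtain M' T' where y: "y = (M', T')" by fastforce
    ultimately obtain f where f: "is_iso f M M'" "f ` T = T'" and X: "x \<in> X" "y \<in> X"
      by (auto simp: tdm_iso_rel_def tdm_iso_iff)
    let ?g = "inv_into (darts M) f"
    have MT: "premap M" "T \<subseteq> darts M" using assms X(1) x by auto
    have "?g ` f ` T = T" by (rule inv_into_image_cancel[OF is_isoD(3)[OF f(1)] MT(2)])
    then have "?g ` T' = T" by (simp only: f(2))
    then have "tdm_iso y x" using is_iso_inv[OF MT(1) f(1)] x y by (auto simp: tdm_iso_iff)
    then show "(y, x) \<in> tdm_iso_rel X" using X by (simp add: tdm_iso_rel_def)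
  qed
  show "trans (tdm_iso_rel X)"
  proof (rule transI)
    fix x y z assume "(x, y) \<in> tdm_iso_rel X" "(y, z) \<in> tdm_iso_rel X"
    moreover obtain M T where x: "x = (M, T)" by fastforce
    moreover obtain M' T' where y: "y = (M', T')" by fastforce
    moreover obtain M'' T'' where z: "z = (M'', T'')" by fastforce
    ultimately obtain f g where f: "is_iso f M M'" "f ` T = T'" and g: "is_iso g M' M''" "g ` T' = T''"
      and X: "x \<in> X" "z \<in> X"
      by (auto simp: tdm_iso_rel_def tdm_iso_iff)
    have "(g \<circ> f) ` T = T''" by (metis f(2) g(2) image_comp)
    then have "tdm_iso x z" using is_iso_comp[OF f(1) g(1)] x z by (auto simp: tdm_iso_iff)
    then show "(x, z) \<in> tdm_iso_rel X" using X by (simp add: tdm_iso_rel_def)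
  qed
qed (auto simp: tdm_iso_rel_def)

lemma TDM_D:
  assumes "(M, T) \<in> TDM e m"
  shows "premap M" "T \<subseteq> darts M" "root M \<in> T" "\<And>d. d \<in> T \<Longrightarrow> alp M d \<in> T"
    "induced M T \<in> PPT m" "nF (induced M T) = 1"
proof -
  show *: "premap M" "T \<subseteq> darts M" "root M \<in> T" "\<And>d. d \<in> T \<Longrightarrow> alp M d \<in> T"
    using assms is_map_premap by (auto simp: TDM_def planar_map_def tree_in_def)
  show "induced M T \<in> PPT m"
    using tree_in_induced_PPT[OF *] assms by (simp add: TDM_def)
  then show "nF (induced M T) = 1" by (simp add: PPT_def)
qed

theorem theorem2:
  fixes e m :: nat
  assumes "m \<ge> 1"
  shows "\<exists>\<Phi>. bij_betw \<Phi> (TDM e m // tdm_iso_rel (TDM e m))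
                 ((PPT m // map_iso_rel (PPT m)) \<times> (S e m // map_iso_rel (S e m))) \<and>
             (\<forall>MT \<in> TDM e m. fst (\<Phi> (tdm_iso_rel (TDM e m) `` {MT})) =
                 map_iso_rel (PPT m) `` {induced (fst MT) (snd MT)})"
proof (rule quotient_product_bij)
  have PPT: "premap A" if "A \<in> PPT m" for A
    using that is_map_premap by (simp add: PPT_def planar_map_def)
  have S: "premap N" if "N \<in> S e m" for N
    using that is_map_premap by (simp add: S_def planar_map_def)
  show "equiv (TDM e m) (tdm_iso_rel (TDM e m))"
    by (rule equiv_tdm_iso_rel) (use TDM_D(1,2) in blast)
  show "equiv (PPT m) (map_iso_rel (PPT m))" "equiv (S e m) (map_iso_rel (S e m))"
    using equiv_map_iso_rel PPT S by blast+
  define tree where "tree MT = induced (fst MT) (snd MT)" for MT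
  \<comment> \<open>An arbitrary choice is harmless, as \<open>cutting_iso\<close> makes all cuts of
    a decorated map isomorphic.\<close>
  define cut where "cut MT = (SOME N. cutting (fst MT) (snd MT) N)" for MT
  have cut: "cutting M T (cut (M, T))" if "(M, T) \<in> TDM e m" for M T
    using someI_ex[OF cut_exists[OF TDM_D(1,2,3,4,6)[OF that]]] by (simp add: cut_def)
  show tree_PPT: "induced (fst x) (snd x) \<in> PPT m" if "x \<in> TDM e m" for x
    using that TDM_D(5) by (cases x) simp
  show cut_S: "cut x \<in> S e m" if "x \<in> TDM e m" for x
    using that cutting.TDM_iff_S[OF cut TDM_D(5)] by (cases x) blast
  show "(x, y) \<in> tdm_iso_rel (TDM e m) \<longleftrightarrow>
      (induced (fst x) (snd x), induced (fst y) (snd y)) \<in> map_iso_rel (PPT m) \<and>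
      (cut x, cut y) \<in> map_iso_rel (S e m)" (is "?L \<longleftrightarrow> ?R")
    if xy: "x \<in> TDM e m" "y \<in> TDM e m" for x y
  proof -
    obtain M T where x: "x = (M, T)" by fastforce
    obtain M' T' where y: "y = (M', T')" by fastforce
    note c = cut[OF xy(1)[unfolded x]] and c' = cut[OF xy(2)[unfolded y]]
    have R: "?R \<longleftrightarrow> (\<exists>g. is_iso g (induced M T) (induced M' T')) \<and>
        (\<exists>h. is_iso h (cut (M, T)) (cut (M', T')))"
      using tree_PPT[OF xy(1)] tree_PPT[OF xy(2)] cut_S[OF xy(1)] cut_S[OF xy(2)]
      by (simp add: map_iso_rel_def map_iso_iff x y)
    have L: "?L \<longleftrightarrow> (\<exists>f. is_iso f M M' \<and> f ` T = T')"
      using xy by (simp add: tdm_iso_rel_def tdm_iso_iff x y)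
    show ?thesis
      unfolding L R
    proof
      assume "\<exists>f. is_iso f M M' \<and> f ` T = T'"
      then obtain f where f: "is_iso f M M'" "f ` T = T'" by blast
      show "(\<exists>g. is_iso g (induced M T) (induced M' T')) \<and> (\<exists>h. is_iso h (cut (M, T)) (cut (M', T')))"
        using is_iso_induced[OF TDM_D(1)[OF xy(1)[unfolded x]] f TDM_D(2,4)[OF xy(1)[unfolded x]]]
          cutting_iso[OF c c' f] by blast
    next
      assume "(\<exists>g. is_iso g (induced M T) (induced M' T')) \<and> (\<exists>h. is_iso h (cut (M, T)) (cut (M', T')))"
      then show "\<exists>f. is_iso f M M' \<and> f ` T = T'"
        using cutting_iso_converse[OF c c'] by blast
    qed
  qed
  show "\<exists>x\<in>TDM e m. (induced (fst x) (snd x), A) \<in> map_iso_rel (PPT m) \<and> (cut x, N) \<in> map_iso_rel (S e m)"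
    if AP: "A \<in> PPT m" and NS: "N \<in> S e m" for A N
  proof -
    have "card (darts A) = 2 * m"
      using AP card_darts_even[OF PPT[OF AP]] dvd_mult_div_cancel[of 2 "card (darts A)"]
      by (simp add: PPT_def nE_def)
    moreover have "nF A = 1" "simple_boundary N m" using AP NS by (simp_all add: PPT_def S_def)
    ultimately obtain M T c where c: "cutting M T N" "is_iso c A (induced M T)"
      using glue_exists[OF S[OF NS] PPT[OF AP]] by blast
    interpret cutting M T N by (rule c(1))
    have ind: "induced M T \<in> PPT m"
      by (rule is_iso_PPT[OF AP premap_induced[OF M T] c(2)])
    then have x: "(M, T) \<in> TDM e m" using TDM_iff_S NS by blast
    have "is_iso (inv_into (darts A) c) (induced M T) A" by (rule is_iso_inv[OF PPT[OF AP] c(2)])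
    then have "(induced M T, A) \<in> map_iso_rel (PPT m)"
      using AP ind by (auto simp: map_iso_rel_def map_iso_iff)
    \<comment> \<open>The chosen cut of the glued map need not be \<open>N\<close>, but both are
      cuts of the same pair.\<close>
    moreover have "\<exists>h. is_iso h (cut (M, T)) N"
      by (rule cutting_iso[OF cut[OF x] c(1) is_iso_id]) simp
    then have "(cut (M, T), N) \<in> map_iso_rel (S e m)"
      using NS cut_S[OF x] by (simp add: map_iso_rel_def map_iso_iff)
    ultimately show ?thesis using x by force
  qed
qed

end
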